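(* Let $n\ge2$, let $\mathcal{H},\mathcal{G}_1,\ldots,\mathcal{G}_{n-1}$ be real Hilbert spaces, let $A_i:\mathcal{G}_i\to2^{\mathcal{G}_i}$ ($i=1,\ldots,n-1$) and $A_n:\mathcal{H}\to2^{\mathcal{H}}$ be maximally monotone, and let $L_i:\mathcal{H}\to\mathcal{G}_i$ ($i=1,\ldots,n-1$) be bounded linear operators. Assume that the set of $x\in\mathcal{H}$ with $0\in A_n(x)+\sum_{i=1}^{n-1}L_i^*A_i(L_ix)$ is nonempty. On $\mathcal{K}:=\mathcal{G}_1\times\cdots\times\mathcal{G}_{n-1}\times\mathcal{H}$, with points $p=(w_1,\ldots,w_{n-1},x)$, define $$Bp:=A_1^{-1}(w_1)\times\cdots\times A_{n-1}^{-1}(w_{n-1})\times A_n(x),$$ $$Kp:=\Big(-L_1x,\ldots,-L_{n-1}x,\;\sum_{i=1}^{n-1}L_i^*w_i\Big),$$ $$Q_kp:=(\tau_{1,k}w_1,\ldots,\tau_{n-1,k}w_{n-1},\tau_{n,k}^{-1}x).$$ Suppose that for all $k\in\mathbb{N}$, $\theta_k\in[\epsilon_\theta,2-\epsilon_\theta]$ for some $\epsilon_\theta\in(0,1)$, and $\tau_{i,k}\in[\epsilon,\frac1\epsilon]$ for all $i=1,\ldots,n$ for some $\epsilon\in(0,1)$ ($\epsilon_\theta,\epsilon$ independent of $k$). Let $p_0\in\mathcal{K}$ and, for $k=0,1,\ldots$, let $$\hat p_k:=(Q_k+B)^{-1}(Q_k-K)p_k,\qquad \mu_k:=\frac{\|p_k-\hat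 p_k\|_{Q_k}^2}{\|(Q_k-K)p_k-(Q_k-K)\hat p_k\|^2},$$ $$p_{k+1}:=p_k-\theta_k\mu_k\big((Q_k-K)p_k-(Q_k-K)\hat p_k\big).$$ Then $(p_k)_{k\in\mathbb{N}}$ converges weakly to some $\bar p\in\mathrm{zer}(B+K):=\{p\in\mathcal{K}:0\in Bp+Kp\}$. Moreover, if $B+K$ is metrically subregular at all $z\in\mathrm{zer}(B+K)$ for $0$ and $\mathcal{K}$ is finite-dimensional, then $p_k\to\bar p\in\mathrm{zer}(B+K)$ locally R-linearly and $\mathrm{dist}(p_k,\mathrm{zer}(B+K))$ converges locally Q-linearly to zero.
   Context: $\mathcal{K}$ carries the product Hilbert space inner product and norm; $\|p\|_{Q_k}=\sqrt{\langle p,Q_kp\rangle}$. $A_i^{-1}$ is the set-valued inverse: $u\in A_i^{-1}(w)$ iff $w\in A_i(u)$. Convention: $\frac00=0$ (relevant for $\mu_k$ when $\hat p_k=p_k$). $\mathrm{dist}(p,H)=\inf_{q\in H}\|p-q\|$ ($+\infty$ if $H=\emptyset$). Metric subregularity: $F:\mathcal{K}\to2^{\mathcal{K}}$ is metrically subregular at $\bar p$ for $\bar y$ if $\bar y\in F\bar p$ and there exist $\kappa\in[0,\infty)$ and neighborhoods $\mathcal{U}$ of $\bar p$ and $\mathcal{V}$ of $\bar y$ such that $\mathrm{dist}(p,F^{-1}\bar y)\le\kappa\,\mathrm{dist}(\bar y,Fp\cap\mathcal{V})$ for all $p\in\mathcal{U}$. A nonnegative sequence $(d_k)$ converges locally Q-linearly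 to zero if there are $K_0\in\mathbb{N}$ and $c\in[0,1)$ with $d_{k+1}\le c\,d_k$ for all $k\ge K_0$; $p_k\to\bar p$ locally R-linearly if there are $K_0\in\mathbb{N}$, $R\ge0$ and $c\in[0,1)$ with $\|p_k-\bar p\|\le Rc^k$ for all $k\ge K_0$. The scheme is a resolvent formulation of synchronous projective splitting. *)

theory Defs
  imports "HOL-Analysis.Analysis" "HOL-Library.Set_Algebras"
begin

text \<open>
  A finite family of Hilbert spaces is represented by a family of closed subspaces
  \<open>G i\<close> of one ambient Hilbert space (their orthogonal direct sum, for instance, is
  such an ambient space). Notions about a Hilbert space are therefore relative to a carrier
  \<open>S\<close>: a set-valued operator on \<open>S\<close> is an element of \<open>S \<rightarrow> Pow S\<close>, and its values at
  points outside \<open>S\<close> never matter. Sums of sets are Minkowski sums.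
\<close>

definition monotone_op_on :: "'a::real_inner set \<Rightarrow> ('a \<Rightarrow> 'a set) \<Rightarrow> bool" where
  "monotone_op_on S A \<longleftrightarrow>
     (\<forall>x\<in>S. \<forall>y\<in>S. \<forall>u\<in>A x. \<forall>v\<in>A y. 0 \<le> inner (x - y) (u - v))"

definition maximally_monotone_on :: "'a::real_inner set \<Rightarrow> ('a \<Rightarrow> 'a set) \<Rightarrow> bool" where
  "maximally_monotone_on S A \<longleftrightarrow>
     A \<in> S \<rightarrow> Pow S \<and> monotone_op_on S A \<and>
     (\<forall>A' \<in> S \<rightarrow> Pow S. monotone_op_on S A' \<and> (\<forall>x\<in>S. A x \<subseteq> A' x) \<longrightarrow> (\<forall>x\<in>S. A' x = A x))"

definition inverse_op :: "'a set \<Rightarrow> ('a \<Rightarrow> 'a set) \<Rightarrow> 'a \<Rightarrow> 'a set" where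
  "inverse_op S A w = {u \<in> S. w \<in> A u}"

definition zer :: "'a::zero set \<Rightarrow> ('a \<Rightarrow> 'a set) \<Rightarrow> 'a set" where
  "zer S F = {p \<in> S. 0 \<in> F p}"

text \<open>Unlike \<^const>\<open>infdist\<close>, the distance to the empty set is infinite.\<close>

definition set_dist :: "'a::metric_space \<Rightarrow> 'a set \<Rightarrow> ereal" where
  "set_dist p H = (if H = {} then \<infinity> else ereal (infdist p H))"

text \<open>
  The value of \<open>0 * \<infinity>\<close> (which is 0 for \<^typ>\<open>ereal\<close>) is immaterial here, since
  \<open>\<kappa>\<close> may be enlarged.
\<close>

definition metrically_subregular_on ::
  "'a::metric_space set \<Rightarrow> ('a \<Rightarrow> 'a set) \<Rightarrow> 'a \<Rightarrow> 'a \<Rightarrow> bool" where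
  "metrically_subregular_on S F pb yb \<longleftrightarrow>
     pb \<in> S \<and> yb \<in> F pb \<and>
     (\<exists>\<kappa>::real. \<exists>U V. 0 \<le> \<kappa> \<and> open U \<and> pb \<in> U \<and> open V \<and> yb \<in> V \<and>
        (\<forall>p \<in> U \<inter> S. set_dist p (inverse_op S F yb) \<le> ereal \<kappa> * set_dist yb (F p \<inter> V)))"

definition converges_weakly_on :: "'a::real_inner set \<Rightarrow> (nat \<Rightarrow> 'a) \<Rightarrow> 'a \<Rightarrow> bool" where
  "converges_weakly_on S p pb \<longleftrightarrow>
     (\<forall>k. p k \<in> S) \<and> pb \<in> S \<and> (\<forall>y\<in>S. (\<lambda>k. inner (p k) y) \<longlonglongrightarrow> inner pb y)"

definition locally_Q_linear_to_zero :: "(nat \<Rightarrow> real) \<Rightarrow> bool" where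
  "locally_Q_linear_to_zero d \<longleftrightarrow>
     (\<forall>k. 0 \<le> d k) \<and> (\<exists>K0. \<exists>c. 0 \<le> c \<and> c < 1 \<and> (\<forall>k\<ge>K0. d (Suc k) \<le> c * d k))"

definition locally_R_linear :: "(nat \<Rightarrow> 'a::real_normed_vector) \<Rightarrow> 'a \<Rightarrow> bool" where
  "locally_R_linear p pb \<longleftrightarrow>
     (\<exists>K0. \<exists>R\<ge>0. \<exists>c. 0 \<le> c \<and> c < 1 \<and> (\<forall>k\<ge>K0. norm (p k - pb) \<le> R * c ^ k))"

text \<open>
  With \<open>n - 1 = CARD('m)\<close>, a point \<open>(w, x)\<close> of the product space is a pair of type
  \<open>('g^'m) \<times> 'h\<close>, whose library inner product is the product one.
\<close>

definition prod_space :: "('m::finite \<Rightarrow> 'g set) \<Rightarrow> (('g^'m) \<times> 'h) set" where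
  "prod_space G = {p. \<forall>i. fst p $ i \<in> G i}"

definition op_B ::
  "('m::finite \<Rightarrow> 'g set) \<Rightarrow> ('m \<Rightarrow> 'g \<Rightarrow> 'g set) \<Rightarrow> ('h \<Rightarrow> 'h set) \<Rightarrow> ('g^'m) \<times> 'h \<Rightarrow> (('g^'m) \<times> 'h) set" where
  "op_B G A An p =
     {q. (\<forall>i. fst q $ i \<in> inverse_op (G i) (A i) (fst p $ i)) \<and> snd q \<in> An (snd p)}"

definition op_K ::
  "('m::finite \<Rightarrow> 'h \<Rightarrow> 'g) \<Rightarrow> ('g::real_inner^'m) \<times> 'h::real_inner \<Rightarrow> ('g^'m) \<times> 'h" where
  "op_K L p = ((\<chi> i. - L i (snd p)), (\<Sum>i\<in>UNIV. adjoint (L i) (fst p $ i)))"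

definition op_Q ::
  "('m::finite \<Rightarrow> real) \<Rightarrow> real \<Rightarrow> ('g::real_vector^'m) \<times> 'h::real_vector \<Rightarrow> ('g^'m) \<times> 'h" where
  "op_Q \<tau> \<tau>n p = ((\<chi> i. \<tau> i *\<^sub>R (fst p $ i)), inverse \<tau>n *\<^sub>R snd p)"

definition weighted_norm :: "('a::real_inner \<Rightarrow> 'a) \<Rightarrow> 'a \<Rightarrow> real" where
  "weighted_norm Q p = sqrt (inner p (Q p))"

end

theory Submission
  imports Defs
begin

text \<open>
  Write \<open>M\<^sub>k = Q\<^sub>k - K\<close>, \<open>e\<^sub>k = p\<^sub>k - q\<^sub>k\<close> with \<open>q\<^sub>k\<close> the resolvent point, and \<open>y\<^sub>k = M\<^sub>k e\<^sub>k\<close>, which is an element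
  of \<open>(B + K) q\<^sub>k\<close>. Monotonicity of \<open>B\<close> and skewness of \<open>K\<close> show that the half-space
  \<open>{z. \<langle>y\<^sub>k, z - q\<^sub>k\<rangle> \<le> 0}\<close> contains all zeros of \<open>B + K\<close>, and \<open>p\<^sub>k\<^sub>+\<^sub>1\<close> is a relaxed projection
  of \<open>p\<^sub>k\<close> onto it. This gives \<open>\<parallel>p\<^sub>k\<^sub>+\<^sub>1 - z\<parallel>\<^sup>2 + \<sigma> \<parallel>e\<^sub>k\<parallel>\<^sup>2 \<le> \<parallel>p\<^sub>k - z\<parallel>\<^sup>2\<close>, so
  \<open>e\<^sub>k\<close> and \<open>y\<^sub>k\<close> tend to zero. Since \<open>B\<close> is maximal, weak cluster points are zeros, and
  Opial's argument yields weak convergence. Under metric subregularity the distance from \<open>p\<^sub>k\<close> to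
  the zeros is eventually \<open>O(\<parallel>e\<^sub>k\<parallel>)\<close>, which turns the descent inequality into a linear rate.

  The resolvent is everywhere defined by Minty's theorem, obtained by minimizing
  \<open>F(x, u) + \<parallel>x\<parallel>\<^sup>2/2 + \<parallel>u\<parallel>\<^sup>2/2\<close> for the Fitzpatrick function \<open>F\<close>.
\<close>

section \<open>Riesz representation and Minty's theorem\<close>

text \<open>The midpoint inequality makes every minimizing sequence Cauchy. \<open>lsc\<close>
  merges closedness of \<open>C\<close> with lower semicontinuity, because an effective domain need
  only be closed along sequences whose values converge.\<close>

lemma strongly_convex_minimizer_exists:
  fixes C :: "'a::{real_normed_vector,complete_space} set" and \<phi> :: "'a \<Rightarrow> real"
  assumes ne: "C \<noteq> {}" and c: "0 < c"
    and bdd: "\<And>x. x \<in> C \<Longrightarrow> m \<le> \<phi> x"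
    and mid: "\<And>x y. x \<in> C \<Longrightarrow> y \<in> C \<Longrightarrow> midpoint x y \<in> C"
      "\<And>x y. x \<in> C \<Longrightarrow> y \<in> C \<Longrightarrow> \<phi> (midpoint x y) \<le> (\<phi> x + \<phi> y) / 2 - c * (dist x y)\<^sup>2"
    and lsc: "\<And>X x l. \<lbrakk>\<And>n. X n \<in> C; X \<longlonglongrightarrow> x; (\<lambda>n. \<phi> (X n)) \<longlonglongrightarrow> l\<rbrakk> \<Longrightarrow> x \<in> C \<and> \<phi> x \<le> l"
  shows "\<exists>x\<in>C. \<forall>y\<in>C. \<phi> x \<le> \<phi> y"
proof -
  define I where "I = Inf (\<phi> ` C)"
  have bb: "bdd_below (\<phi> ` C)" using bdd by (auto intro!: bdd_belowI2)
  have I: "I \<le> \<phi> x" if "x \<in> C" for x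
    unfolding I_def using bb that by (rule cINF_lower)
  have "\<exists>x\<in>C. \<phi> x < I + 1 / real (Suc n)" for n
    using cINF_less_iff[OF ne bb, of "I + 1 / real (Suc n)"] by (simp add: I_def)
  then obtain X where X: "\<And>n. X n \<in> C" "\<And>n. \<phi> (X n) < I + 1 / real (Suc n)" by metis
  have lim: "(\<lambda>n. \<phi> (X n)) \<longlonglongrightarrow> I"
  proof (rule tendsto_sandwich[of "\<lambda>_. I" _ _ "\<lambda>n. I + 1 / real (Suc n)"])
    show "(\<lambda>n. I + 1 / real (Suc n)) \<longlonglongrightarrow> I"
      using tendsto_add[OF tendsto_const LIMSEQ_inverse_real_of_nat, of I]
      by (simp add: inverse_eq_divide)
  qed (use X I in \<open>auto intro!: always_eventually less_imp_le\<close>)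
  have "Cauchy X"
  proof (rule metric_CauchyI)
    fix e :: real assume e: "0 < e"
    obtain N where "1 / real (Suc N) < c * e\<^sup>2"
      using reals_Archimedean[of "c * e\<^sup>2"] c e by (auto simp: inverse_eq_divide)
    moreover define \<delta> where "\<delta> = 1 / real (Suc N)"
    ultimately have N: "\<delta> < c * e\<^sup>2" by simp
    have "dist (X i) (X j) < e" if "i \<ge> N" "j \<ge> N" for i j
    proof -
      have "1 / real (Suc i) \<le> \<delta>" "1 / real (Suc j) \<le> \<delta>"
        using that by (auto simp: divide_simps \<delta>_def)
      then have "\<phi> (X i) < I + \<delta>" "\<phi> (X j) < I + \<delta>"
        using X(2)[of i] X(2)[of j] by linarith+
      moreover have "I \<le> (\<phi> (X i) + \<phi> (X j)) / 2 - c * (dist (X i) (X j))\<^sup>2"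
        using I[OF mid(1)[OF X(1) X(1)], of i j] mid(2)[OF X(1) X(1), of i j] by linarith
      ultimately have "c * (dist (X i) (X j))\<^sup>2 < c * e\<^sup>2" using N by argo
      then show ?thesis using c e by (simp add: power_less_imp_less_base)
    qed
    then show "\<exists>M. \<forall>i\<ge>M. \<forall>j\<ge>M. dist (X i) (X j) < e" by blast
  qed
  then obtain x where "X \<longlonglongrightarrow> x" using Cauchy_convergent convergentD by blast
  then have "x \<in> C \<and> \<phi> x \<le> I" using X(1) lim by (intro lsc)
  then show ?thesis using I by force
qed

text \<open>Parallelogram law. It supplies the modulus \<open>1/8\<close> for both minimizations
  below.\<close>

lemma norm_midpoint_sq:
  fixes x y :: "'a::real_inner"
  shows "(norm (midpoint x y))\<^sup>2 / 2 = ((norm x)\<^sup>2 / 2 + (norm y)\<^sup>2 / 2) / 2 - 1/8 * (dist x y)\<^sup>2"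
  unfolding dist_norm midpoint_def power2_norm_eq_inner
  by (simp add: algebra_simps inner_commute) argo

lemma midpoint_in_subspace: "subspace S \<Longrightarrow> x \<in> S \<Longrightarrow> y \<in> S \<Longrightarrow> midpoint x y \<in> S"
  unfolding midpoint_def by (intro subspace_scale subspace_add)

text \<open>First-order condition at a minimizer: divide by \<open>t\<close> and let
  \<open>t\<close> decrease to zero.\<close>

lemma nonneg_coeff_of_quadratic:
  fixes a b :: real
  assumes "\<And>t. 0 < t \<Longrightarrow> t \<le> 1 \<Longrightarrow> 0 \<le> t * a + t\<^sup>2 * b"
  shows "0 \<le> a"
proof (rule tendsto_lowerbound[where F="at_right (0::real)"])
  show "((\<lambda>t. a + t * b) \<longlongrightarrow> a) (at_right 0)" by (auto intro!: tendsto_eq_intros)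
  have "0 \<le> a + t * b" if "0 < t" "t \<le> 1" for t
  proof -
    have "0 \<le> t * (a + t * b)" using assms[OF that] by (simp add: algebra_simps power2_eq_square)
    then show ?thesis using that by (simp add: zero_le_mult_iff)
  qed
  then show "\<forall>\<^sub>F t in at_right 0. 0 \<le> a + t * b"
    unfolding eventually_at_right_field by (intro exI[of _ 1]) auto
qed auto

section \<open>Riesz representation and adjoints\<close>

text \<open>The representer is the minimizer of \<open>(norm x)\<^sup>2 / 2 - f x\<close> on
  \<open>S\<close>; its Euler equation is the claim.\<close>

lemma riesz_representation_on:
  fixes f :: "'a::{real_inner,complete_space} \<Rightarrow> real"
  assumes S: "subspace S" "closed S" and f: "bounded_linear f"
  shows "\<exists>z\<in>S. \<forall>y\<in>S. f y = inner z y"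
proof -
  interpret f: bounded_linear f by fact
  obtain K where K: "\<And>x. norm (f x) \<le> norm x * K" using f.bounded by blast
  have "\<exists>x\<in>S. \<forall>y\<in>S. (norm x)\<^sup>2 / 2 - f x \<le> (norm y)\<^sup>2 / 2 - f y"
  proof (rule strongly_convex_minimizer_exists[where c="1/8" and m="- K\<^sup>2 / 2"])
    show "S \<noteq> {}" using subspace_0[OF S(1)] by blast
    \<comment> \<open>Bound \<open>f x\<close> by \<open>norm x * K\<close> and complete the
      square.\<close>
    show "- K\<^sup>2 / 2 \<le> (norm x)\<^sup>2 / 2 - f x" for x
      using K[of x] zero_le_power2[of "norm x - K"]
      by (simp add: power2_eq_square algebra_simps abs_le_iff)
    show "midpoint x y \<in> S" if "x \<in> S" "y \<in> S" for x y
      using S(1) that by (rule midpoint_in_subspace)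
    show "(norm (midpoint x y))\<^sup>2 / 2 - f (midpoint x y)
        \<le> ((norm x)\<^sup>2 / 2 - f x + ((norm y)\<^sup>2 / 2 - f y)) / 2 - 1 / 8 * (dist x y)\<^sup>2" for x y
      using norm_midpoint_sq[of x y] by (simp add: midpoint_def f.add f.scale algebra_simps)
    show "x \<in> S \<and> (norm x)\<^sup>2 / 2 - f x \<le> l"
      if X: "\<And>n. X n \<in> S" "X \<longlonglongrightarrow> x" and l: "(\<lambda>n. (norm (X n))\<^sup>2 / 2 - f (X n)) \<longlonglongrightarrow> l" for X x l
    proof
      show "x \<in> S" using S(2) X closed_sequentially by blast
      have "(\<lambda>n. (norm (X n))\<^sup>2 / 2 - f (X n)) \<longlonglongrightarrow> (norm x)\<^sup>2 / 2 - f x"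
        by (intro tendsto_intros f.tendsto X(2)) auto
      then show "(norm x)\<^sup>2 / 2 - f x \<le> l" using l LIMSEQ_unique by blast
    qed
  qed auto
  then obtain z where z: "z \<in> S" "\<And>y. y \<in> S \<Longrightarrow> (norm z)\<^sup>2 / 2 - f z \<le> (norm y)\<^sup>2 / 2 - f y" by blast
  have le: "f y \<le> inner z y" if "y \<in> S" for y
  proof -
    \<comment> \<open>Compare the minimizer \<open>z\<close> with its perturbation
      \<open>z + t *\<^sub>R y\<close>, which stays in \<open>S\<close>.\<close>
    have "0 \<le> t * (inner z y - f y) + t\<^sup>2 * ((norm y)\<^sup>2 / 2)" for t
      using z(2)[of "z + t *\<^sub>R y"] z(1) that S(1)
      unfolding power2_norm_eq_inner
      by (simp add: subspace_add subspace_scale f.add f.scale algebra_simps inner_commute power2_eq_square)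
    then have "0 \<le> inner z y - f y" by (rule nonneg_coeff_of_quadratic)
    then show ?thesis by simp
  qed
  \<comment> \<open>The inequality at \<open>- y\<close> is the reverse inequality at
    \<open>y\<close>.\<close>
  have "f y = inner z y" if "y \<in> S" for y
    using le[OF that] le[OF subspace_neg[OF S(1) that]] by (simp add: f.neg)
  then show ?thesis using z(1) by blast
qed

text \<open>\<open>adjoint\<close> is defined by choice, so its characteristic identity rests on the
  existence of some adjoint; Riesz applied to \<open>\<lambda>x. inner (f x) y\<close> provides
  one.\<close>

lemma adjoint_bounded_linear:
  fixes f :: "'a::{real_inner,complete_space} \<Rightarrow> 'b::real_inner"
  assumes f: "bounded_linear f"
  shows "inner (f x) y = inner x (adjoint f y)" "bounded_linear (adjoint f)"
proof -
  interpret f: bounded_linear f by fact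
  have "\<exists>z. \<forall>x. inner (f x) y = inner x z" for y
    using riesz_representation_on[of UNIV "\<lambda>x. inner (f x) y"]
      bounded_linear_compose[OF bounded_linear_inner_left f]
    by (auto simp: inner_commute)
  then have "\<exists>f'. \<forall>x y. inner (f x) y = inner x (f' y)" by metis
  then have "\<forall>x y. inner (f x) y = inner x (adjoint f y)"
    unfolding adjoint_def by (rule someI_ex)
  then show adj: "inner (f x) y = inner x (adjoint f y)" for x y by blast
  obtain K where K: "0 \<le> K" "\<And>x. norm (f x) \<le> norm x * K" using f.nonneg_bounded by blast
  show "bounded_linear (adjoint f)"
  proof (rule bounded_linear_intro[where K=K])
    show "adjoint f (x + y) = adjoint f x + adjoint f y" for x y
      by (rule vector_eq_ldot[THEN iffD1]) (simp add: adj[symmetric] inner_add_right)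
    show "adjoint f (r *\<^sub>R x) = r *\<^sub>R adjoint f x" for r x
      by (rule vector_eq_ldot[THEN iffD1]) (simp add: adj[symmetric])
    show "norm (adjoint f y) \<le> norm y * K" for y
    proof -
      \<comment> \<open>Testing the identity at \<open>adjoint f y\<close> itself carries the bound
        \<open>K\<close> of \<open>f\<close> over to the adjoint.\<close>
      have "norm (adjoint f y) * norm (adjoint f y) = inner (f (adjoint f y)) y"
        by (simp add: adj dot_square_norm power2_eq_square)
      also have "\<dots> \<le> norm (f (adjoint f y)) * norm y" by (rule norm_cauchy_schwarz)
      also have "\<dots> \<le> norm (adjoint f y) * K * norm y" by (intro mult_right_mono K) auto
      finally have "norm (adjoint f y) * norm (adjoint f y) \<le> norm (adjoint f y) * (norm y * K)"
        by (simp add: mult_ac)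
      then show ?thesis using K by (cases "adjoint f y = 0") auto
    qed
  qed
qed

section \<open>Maximal monotonicity in terms of graphs\<close>

text \<open>A pair monotonically related to the whole graph can be adjoined without destroying
  monotonicity, so maximality means that it was there already.\<close>

lemma maximally_monotone_on_mem:
  assumes A: "maximally_monotone_on S A" and "x \<in> S" "u \<in> S"
    and rel: "\<And>a b. a \<in> S \<Longrightarrow> b \<in> A a \<Longrightarrow> 0 \<le> inner (x - a) (u - b)"
  shows "u \<in> A x"
proof -
  define A' where "A' = A(x := insert u (A x))"
  have AS: "A \<in> S \<rightarrow> Pow S" using A unfolding maximally_monotone_on_def by blast
  have rel': "0 \<le> inner (a - x) (b - u)" if "a \<in> S" "b \<in> A a" for a b
    using rel[OF that] by (simp add: algebra_simps)
  have "monotone_op_on S A" using A by (simp add: maximally_monotone_on_def)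
  then have mon: "0 \<le> inner (y - z) (v - w)" if "y \<in> S" "z \<in> S" "v \<in> A y" "w \<in> A z" for y z v w
    using that by (auto simp: monotone_op_on_def)
  have mem: "w \<in> A' y \<longleftrightarrow> w \<in> A y \<or> (y = x \<and> w = u)" for w y by (auto simp: A'_def)
  have "monotone_op_on S A'"
    unfolding monotone_op_on_def
  proof (intro ballI)
    fix y z v w assume yz: "y \<in> S" "z \<in> S" and "v \<in> A' y" "w \<in> A' z"
    then consider "v \<in> A y" "w \<in> A z" | "v \<in> A y" "z = x" "w = u"
      | "y = x" "v = u" "w \<in> A z" | "y = x" "v = u" "z = x" "w = u"
      unfolding mem by blast
    then show "0 \<le> inner (y - z) (v - w)"
    proof cases
      case 1 then show ?thesis using mon yz by blast
    next
      case 2 then show ?thesis using rel' yz by blast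
    next
      case 3 then show ?thesis using rel yz by blast
    qed simp
  qed
  moreover have "A' \<in> S \<rightarrow> Pow S"
    using AS assms(2,3) by (auto simp: A'_def Pi_iff split: if_splits)
  moreover have "\<forall>y\<in>S. A y \<subseteq> A' y" by (auto simp: A'_def)
  ultimately have "A' x = A x" using A \<open>x \<in> S\<close> unfolding maximally_monotone_on_def by blast
  then show ?thesis by (auto simp: A'_def)
qed

text \<open>Converse criterion: every pair of a monotone extension is monotonically related to the
  graph of \<open>A\<close>.\<close>

lemma maximally_monotone_onI:
  assumes "A \<in> S \<rightarrow> Pow S" "monotone_op_on S A"
    and "\<And>x u. \<lbrakk>x \<in> S; u \<in> S; \<And>a b. a \<in> S \<Longrightarrow> b \<in> A a \<Longrightarrow> 0 \<le> inner (x - a) (u - b)\<rbrakk> \<Longrightarrow> u \<in> A x"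
  shows "maximally_monotone_on S A"
  unfolding maximally_monotone_on_def
proof (intro conjI ballI impI assms(1,2))
  fix A' x
  assume A': "A' \<in> S \<rightarrow> Pow S" "monotone_op_on S A' \<and> (\<forall>x\<in>S. A x \<subseteq> A' x)" and x: "x \<in> S"
  have "A' x \<subseteq> A x"
  proof
    fix u assume u: "u \<in> A' x"
    show "u \<in> A x"
    proof (rule assms(3)[OF x])
      show "u \<in> S" using A'(1) x u by blast
      show "0 \<le> inner (x - a) (u - b)" if "a \<in> S" "b \<in> A a" for a b
        using A'(2) x u that unfolding monotone_op_on_def by blast
    qed
  qed
  then show "A' x = A x" using A'(2) x by blast
qed

text \<open>Inversion swaps the coordinates of the graph, and monotone relatedness is symmetric in
  them.\<close>

lemma maximally_monotone_on_inverse: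
  assumes "maximally_monotone_on S A"
  shows "maximally_monotone_on S (inverse_op S A)"
proof (rule maximally_monotone_onI)
  have A: "A \<in> S \<rightarrow> Pow S" "monotone_op_on S A"
    using assms by (auto simp: maximally_monotone_on_def)
  show "inverse_op S A \<in> S \<rightarrow> Pow S" by (auto simp: inverse_op_def)
  show "monotone_op_on S (inverse_op S A)"
    unfolding monotone_op_on_def
  proof (intro ballI)
    fix x y u v assume "x \<in> S" "y \<in> S" "u \<in> inverse_op S A x" "v \<in> inverse_op S A y"
    then have "0 \<le> inner (u - v) (x - y)"
      using A(2) unfolding monotone_op_on_def inverse_op_def by blast
    then show "0 \<le> inner (x - y) (u - v)" by (simp only: inner_commute)
  qed
  show "u \<in> inverse_op S A x"
    if "x \<in> S" "u \<in> S"
      and rel: "\<And>a b. a \<in> S \<Longrightarrow> b \<in> inverse_op S A a \<Longrightarrow> 0 \<le> inner (x - a) (u - b)" for x u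
  proof -
    have "0 \<le> inner (u - a) (x - b)" if ab: "a \<in> S" "b \<in> A a" for a b
    proof -
      have "b \<in> S" "a \<in> inverse_op S A b" using ab A(1) by (auto simp: inverse_op_def)
      then have "0 \<le> inner (x - b) (u - a)" by (rule rel)
      then show ?thesis by (simp only: inner_commute)
    qed
    then have "x \<in> A u" using maximally_monotone_on_mem[OF assms \<open>u \<in> S\<close> \<open>x \<in> S\<close>] by blast
    then show ?thesis using \<open>u \<in> S\<close> by (simp add: inverse_op_def)
  qed
qed

section \<open>Minty's theorem and its converse\<close>

text \<open>At the minimizer \<open>(x, u)\<close> of the regularized Fitzpatrick function,
  optimality against graph points shows that \<open>(- u, - x)\<close> is monotonically related to
  the graph. Being in the graph, it forces \<open>x + u = 0\<close>.\<close>

lemma minty_surjective_zero: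
  fixes S :: "'a::{real_inner,complete_space} set"
  assumes S: "subspace S" "closed S" and A: "maximally_monotone_on S A"
  shows "\<exists>x\<in>S. - x \<in> A x"
proof -
  define f where "f = (\<lambda>(a,b) (x::'a,u::'a). inner x b + inner a u - inner a b :: real)"
  define gr where "gr = {(a, b). a \<in> S \<and> b \<in> A a}"
  \<comment> \<open>The Fitzpatrick function \<open>F\<close> is the supremum of the affine
    functions \<open>f g\<close> over the graph \<open>gr\<close>. A real supremum is meaningful
    only for bounded families, so \<open>D\<close> serves as the effective domain of
    \<open>F\<close>.\<close>
  define D where "D = {w \<in> S \<times> S. bdd_above ((\<lambda>g. f g w) ` gr)}"
  define F where "F w = (SUP g\<in>gr. f g w)" for w
  define \<phi> where "\<phi> w = F w + (norm w)\<^sup>2 / 2" for w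
  have AS: "A \<in> S \<rightarrow> Pow S" and mon: "monotone_op_on S A"
    using A by (auto simp: maximally_monotone_on_def)
  have memgr: "(x, u) \<in> gr" if "x \<in> S" "u \<in> S" "\<And>a b. (a, b) \<in> gr \<Longrightarrow> 0 \<le> inner (x - a) (u - b)" for x u
    using maximally_monotone_on_mem[OF A that(1,2)] that by (auto simp: gr_def)
  have grS: "a \<in> S" "b \<in> S" if "(a, b) \<in> gr" for a b using that AS by (auto simp: gr_def)
  \<comment> \<open>The pair \<open>(0, 0)\<close> would be vacuously related to an empty graph and
    hence belong to it.\<close>
  have grne: "gr \<noteq> {}"
    using memgr[of 0 0] subspace_0[OF S(1)] by blast
  \<comment> \<open>This identity translates between bounds on \<open>F\<close> and monotone
    relatedness.\<close>
  have f_rel: "inner x u - f (a, b) (x, u) = inner (x - a) (u - b)" for a b x u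
    by (simp add: f_def algebra_simps)
  have le_F: "f g w \<le> F w" if "w \<in> D" "g \<in> gr" for g w
    unfolding F_def using that by (intro cSUP_upper) (auto simp: D_def)
  have F_leI: "w \<in> D \<and> F w \<le> t" if "w \<in> S \<times> S" "\<And>g. g \<in> gr \<Longrightarrow> f g w \<le> t" for w t
    using that grne by (auto simp: D_def F_def intro!: cSUP_least bdd_aboveI2[of _ _ t])
  \<comment> \<open>If \<open>F\<close> were below the pairing, \<open>(x, u)\<close> would lie in
    the graph, where its own affine function attains the pairing.\<close>
  have F_ge: "inner x u \<le> F (x, u)" if "(x, u) \<in> D" for x u
  proof (rule ccontr)
    assume "\<not> inner x u \<le> F (x, u)"
    then have less: "f g (x, u) < inner x u" if "g \<in> gr" for g
      using le_F[OF \<open>(x, u) \<in> D\<close> that] by linarith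
    have "(x, u) \<in> gr"
    proof (rule memgr)
      show "0 \<le> inner (x - a) (u - b)" if "(a, b) \<in> gr" for a b
        using less[OF that] f_rel[of x u a b] by linarith
    qed (use \<open>(x, u) \<in> D\<close> in \<open>auto simp: D_def\<close>)
    from less[OF this] show False by (simp add: f_def)
  qed
  have F_gr: "(a, b) \<in> D \<and> F (a, b) \<le> inner a b" if "(a, b) \<in> gr" for a b
  proof (rule F_leI)
    show "(a, b) \<in> S \<times> S" using that grS by auto
    show "f g (a, b) \<le> inner a b" if "g \<in> gr" for g
    proof -
      obtain a' b' where g: "g = (a', b')" by force
      have "0 \<le> inner (a - a') (b - b')"
        using mon \<open>(a, b) \<in> gr\<close> that unfolding monotone_op_on_def gr_def g by blast
      then show ?thesis using f_rel[of a b a' b'] g by simp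
    qed
  qed
  have f_affine: "f g ((1 - t) *\<^sub>R w + t *\<^sub>R v) = (1 - t) * f g w + t * f g v" for g t v w
    by (cases g; cases v; cases w) (simp add: f_def algebra_simps)
  have conv: "(1 - t) *\<^sub>R w + t *\<^sub>R v \<in> D \<and> F ((1 - t) *\<^sub>R w + t *\<^sub>R v) \<le> (1 - t) * F w + t * F v"
    if "w \<in> D" "v \<in> D" "0 \<le> t" "t \<le> 1" for w v t
  proof (rule F_leI)
    show "(1 - t) *\<^sub>R w + t *\<^sub>R v \<in> S \<times> S"
      using that S(1) by (auto simp: D_def mem_Times_iff intro!: subspace_add subspace_scale)
    show "f g ((1 - t) *\<^sub>R w + t *\<^sub>R v) \<le> (1 - t) * F w + t * F v" if "g \<in> gr" for g
      unfolding f_affine using le_F that \<open>w \<in> D\<close> \<open>v \<in> D\<close> \<open>0 \<le> t\<close> \<open>t \<le> 1\<close>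
      by (intro add_mono mult_left_mono) auto
  qed
  have mid: "midpoint w v = (1 - 1/2) *\<^sub>R w + (1/2) *\<^sub>R v" for w v :: "'a \<times> 'a"
    by (simp add: midpoint_def scaleR_add_right)
  have "\<exists>w\<in>D. \<forall>v\<in>D. \<phi> w \<le> \<phi> v"
  proof (rule strongly_convex_minimizer_exists[where c="1/8" and m=0])
    show "D \<noteq> {}" using grne F_gr by auto
    \<comment> \<open>Replacing \<open>F\<close> by the smaller pairing \<open>inner x u\<close>
      completes the square with the norm term.\<close>
    show "0 \<le> \<phi> w" if "w \<in> D" for w
    proof -
      obtain x u where w: "w = (x, u)" by force
      have "0 \<le> (norm (x + u))\<^sup>2 / 2" by simp
      also have "\<dots> = inner x u + (norm w)\<^sup>2 / 2"
        by (simp add: w power2_norm_eq_inner algebra_simps inner_commute)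
      finally show ?thesis using F_ge that by (force simp: \<phi>_def w)
    qed
    show "midpoint w v \<in> D" if "w \<in> D" "v \<in> D" for w v
      unfolding mid using conv[OF that, of "1/2"] by simp
    show "\<phi> (midpoint w v) \<le> (\<phi> w + \<phi> v) / 2 - 1 / 8 * (dist w v)\<^sup>2" if "w \<in> D" "v \<in> D" for w v
      using norm_midpoint_sq[of w v] conv[OF that, of "1/2"] by (simp add: \<phi>_def mid field_simps)
    show "w \<in> D \<and> \<phi> w \<le> l"
      if X: "\<And>n. X n \<in> D" "X \<longlonglongrightarrow> w" and l: "(\<lambda>n. \<phi> (X n)) \<longlonglongrightarrow> l" for X w l
    proof -
      have "w \<in> D \<and> F w \<le> l - (norm w)\<^sup>2 / 2"
      proof (rule F_leI)
        have "closed (S \<times> S)" using S(2) by (intro closed_Times)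
        then show "w \<in> S \<times> S" using X closed_sequentially[of "S \<times> S" X w] by (auto simp: D_def)
        show "f g w \<le> l - (norm w)\<^sup>2 / 2" if "g \<in> gr" for g
        proof (rule LIMSEQ_le)
          obtain a b where g: "g = (a, b)" by force
          show "(\<lambda>n. f g (X n)) \<longlonglongrightarrow> f g w"
            unfolding g f_def case_prod_beta fst_conv snd_conv by (intro tendsto_intros X(2))
          show "(\<lambda>n. \<phi> (X n) - (norm (X n))\<^sup>2 / 2) \<longlonglongrightarrow> l - (norm w)\<^sup>2 / 2"
            by (intro tendsto_intros l X(2)) auto
          show "\<exists>N. \<forall>n\<ge>N. f g (X n) \<le> \<phi> (X n) - (norm (X n))\<^sup>2 / 2"
            using le_F[OF X(1) that] by (simp add: \<phi>_def)
        qed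
      qed
      then show ?thesis by (simp add: \<phi>_def)
    qed
  qed auto
  then obtain w where wD: "w \<in> D" and wmin: "\<And>v. v \<in> D \<Longrightarrow> \<phi> w \<le> \<phi> v" by blast
  \<comment> \<open>Along the segment from \<open>w\<close> to \<open>v\<close>, \<open>F\<close> is
    estimated by convexity and the squared norm is expanded exactly.\<close>
  have opt: "0 \<le> F v - F w + inner w (v - w)" if vD: "v \<in> D" for v
  proof (rule nonneg_coeff_of_quadratic)
    fix t :: real assume t: "0 < t" "t \<le> 1"
    have eq: "(1 - t) *\<^sub>R w + t *\<^sub>R v = w + t *\<^sub>R (v - w)" by (simp add: algebra_simps)
    have "\<phi> w \<le> \<phi> (w + t *\<^sub>R (v - w))" and "F (w + t *\<^sub>R (v - w)) \<le> (1 - t) * F w + t * F v"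
      using conv[OF wD vD, of t] t wmin unfolding eq by auto
    moreover have "(norm (w + t *\<^sub>R (v - w)))\<^sup>2 = (norm w)\<^sup>2 + 2 * t * inner w (v - w) + t\<^sup>2 * (norm (v - w))\<^sup>2"
      unfolding power2_norm_eq_inner by (simp add: algebra_simps inner_commute power2_eq_square)
    ultimately show "0 \<le> t * (F v - F w + inner w (v - w)) + t\<^sup>2 * ((norm (v - w))\<^sup>2 / 2)"
      by (simp add: \<phi>_def algebra_simps)
  qed
  obtain x u where w: "w = (x, u)" by force
  have xuS: "x \<in> S" "u \<in> S" using wD by (auto simp: D_def w)
  \<comment> \<open>Optimality at a graph point, where \<open>F (a, b)\<close> is at most
    \<open>inner a b\<close>, combined with the lower bound \<open>inner x u\<close> for
    \<open>F w\<close>.\<close>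
  have key: "(norm (x + u))\<^sup>2 \<le> inner (- u - a) (- x - b)" if "(a, b) \<in> gr" for a b
  proof -
    have "inner x u \<le> F w" "F (a, b) \<le> inner a b" "0 \<le> F (a, b) - F w + inner w ((a, b) - w)"
      using F_ge wD F_gr[OF that] opt by (auto simp: w)
    then show ?thesis unfolding power2_norm_eq_inner by (simp add: w algebra_simps inner_commute)
  qed
  have "(- u, - x) \<in> gr"
  proof (rule memgr)
    show "0 \<le> inner (- u - a) (- x - b)" if "(a, b) \<in> gr" for a b
      using key[OF that] zero_le_power2[of "norm (x + u)"] by linarith
  qed (use xuS S(1) subspace_neg in auto)
  \<comment> \<open>At the graph point \<open>(- u, - x)\<close> the right-hand side of
    \<open>key\<close> is zero.\<close>
  moreover from key[OF this] have "x + u = 0" by simp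
  then have "- u = x" by (metis add_eq_0_iff2 minus_minus)
  ultimately show ?thesis by (auto simp: gr_def)
qed

text \<open>Reduction to the previous case: \<open>A'\<close> has the values of \<open>A\<close>
  shifted by \<open>- z\<close> and divided by \<open>c\<close>, and inherits maximality.\<close>

lemma minty_surjective:
  fixes S :: "'a::{real_inner,complete_space} set"
  assumes S: "subspace S" "closed S" and A: "maximally_monotone_on S A"
    and "0 < c" "z \<in> S"
  shows "\<exists>x\<in>S. z - c *\<^sub>R x \<in> A x"
proof -
  define A' where "A' x = {u \<in> S. z + c *\<^sub>R u \<in> A x}" for x
  have AS: "A \<in> S \<rightarrow> Pow S" and mon: "monotone_op_on S A"
    using A by (auto simp: maximally_monotone_on_def)
  have "maximally_monotone_on S A'"
  proof (rule maximally_monotone_onI)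
    show "A' \<in> S \<rightarrow> Pow S" by (auto simp: A'_def)
    show "monotone_op_on S A'"
      unfolding monotone_op_on_def
    proof (intro ballI)
      fix x y u v assume "x \<in> S" "y \<in> S" "u \<in> A' x" "v \<in> A' y"
      then have "0 \<le> inner (x - y) ((z + c *\<^sub>R u) - (z + c *\<^sub>R v))"
        using mon unfolding monotone_op_on_def A'_def by blast
      also have "(z + c *\<^sub>R u) - (z + c *\<^sub>R v) = c *\<^sub>R (u - v)" by (simp add: algebra_simps)
      finally show "0 \<le> inner (x - y) (u - v)" using \<open>0 < c\<close> by (simp add: zero_le_mult_iff)
    qed
    show "u \<in> A' x" if "x \<in> S" "u \<in> S"
      and rel: "\<And>a b. a \<in> S \<Longrightarrow> b \<in> A' a \<Longrightarrow> 0 \<le> inner (x - a) (u - b)" for x u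
    proof -
      have "z + c *\<^sub>R u \<in> A x"
      proof (rule maximally_monotone_on_mem[OF A])
        show "z + c *\<^sub>R u \<in> S" using S(1) that assms(5) by (simp add: subspace_add subspace_scale)
        fix a b assume ab: "a \<in> S" "b \<in> A a"
        define b' where "b' = (1 / c) *\<^sub>R (b - z)"
        have b: "b = z + c *\<^sub>R b'" using \<open>0 < c\<close> by (simp add: b'_def)
        have "b \<in> S" using AS ab by blast
        then have "b' \<in> A' a" using ab S(1) assms(5) unfolding A'_def
          by (simp add: b[symmetric]) (simp add: b'_def subspace_scale subspace_diff)
        then have "0 \<le> inner (x - a) (u - b')" using rel ab by blast
        then have "0 \<le> c * inner (x - a) (u - b')" using \<open>0 < c\<close> by simp
        also have "\<dots> = inner (x - a) (z + c *\<^sub>R u - b)" by (simp add: b algebra_simps)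
        finally show "0 \<le> inner (x - a) (z + c *\<^sub>R u - b)" .
      qed (fact that)
      then show ?thesis using that by (simp add: A'_def)
    qed
  qed
  from minty_surjective_zero[OF S this] show ?thesis by (auto simp: A'_def)
qed

text \<open>For a related pair \<open>(x, u)\<close>, surjectivity gives a graph point with the same
  sum \<open>x + u\<close>. Relatedness to that point reads
  \<open>0 \<le> - (norm (x - a))\<^sup>2\<close>, so the two coincide.\<close>

lemma monotone_surjective_imp_maximal:
  assumes S: "subspace S" and A: "A \<in> S \<rightarrow> Pow S" "monotone_op_on S A"
    and surj: "\<And>z. z \<in> S \<Longrightarrow> \<exists>x\<in>S. z - x \<in> A x"
  shows "maximally_monotone_on S A"
proof (rule maximally_monotone_onI[OF A])
  fix x u assume xu: "x \<in> S" "u \<in> S"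
    and rel: "\<And>a b. a \<in> S \<Longrightarrow> b \<in> A a \<Longrightarrow> 0 \<le> inner (x - a) (u - b)"
  obtain a where a: "a \<in> S" "x + u - a \<in> A a" using surj[of "x + u"] S xu subspace_add by blast
  have "0 \<le> inner (x - a) (u - (x + u - a))" using rel a by blast
  then have "inner (x - a) (x - a) \<le> 0" by (simp add: algebra_simps)
  then have "x = a" by (metis eq_iff_diff_eq_0 inner_eq_zero_iff inner_ge_zero order_antisym)
  then show "u \<in> A x" using a by simp
qed

section \<open>Fejer monotone sequences\<close>

text \<open>Banach-Alaoglu: the functionals \<open>inner (p k)\<close> lie in a product of compact
  intervals, compact by Tychonoff, and Riesz represents a cluster functional within
  \<open>S\<close>. Finer filters take the place of subsequences.\<close>

lemma weak_cluster_point_exists: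
  fixes p :: "'i \<Rightarrow> 'a::{real_inner,complete_space}"
  assumes S: "subspace S" "closed S" and F: "F \<noteq> bot" and R: "\<And>k. norm (p k) \<le> R"
  shows "\<exists>z\<in>S. \<exists>F'. F' \<le> F \<and> F' \<noteq> bot \<and> (\<forall>y\<in>S. ((\<lambda>k. inner (p k) y) \<longlongrightarrow> inner z y) F')"
proof -
  define \<Phi> where "\<Phi> k = (\<lambda>y. inner (p k) y)" for k
  define U where "U = Pi\<^sub>E UNIV (\<lambda>y::'a. cball (0::real) (R * norm y))"
  have "compact U"
    using compactin_PiE[of "\<lambda>_. euclidean" UNIV "\<lambda>y::'a. cball (0::real) (R * norm y)"]
    by (simp add: U_def euclidean_product_topology)
  moreover have \<Phi>U: "\<Phi> k \<in> U" for k
  proof -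
    have "\<bar>inner (p k) y\<bar> \<le> R * norm y" for y
      using Cauchy_Schwarz_ineq2[of "p k" y] mult_right_mono[OF R[of k] norm_ge_zero[of y]]
      by linarith
    then show ?thesis by (simp add: U_def \<Phi>_def PiE_def Pi_def)
  qed
  moreover have "filtermap \<Phi> F \<noteq> bot" using F by (simp add: filtermap_bot_iff)
  moreover have "eventually (\<lambda>x. x \<in> U) (filtermap \<Phi> F)"
    unfolding eventually_filtermap using \<Phi>U by simp
  ultimately obtain l where l: "l \<in> U" "inf (nhds l) (filtermap \<Phi> F) \<noteq> bot"
    unfolding compact_filter by blast
  \<comment> \<open>\<open>F\<close> refined by the pullback of the neighborhoods of
    \<open>l\<close>. It is proper because \<open>l\<close> is a cluster point of the image
    filter.\<close>
  define F' where "F' = inf (filtercomap \<Phi> (nhds l)) F"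
  have F'bot: "F' \<noteq> bot"
  proof
    assume "F' = bot"
    then have "eventually (\<lambda>_. False) F'" by simp
    then obtain P T where P: "eventually P (filtercomap \<Phi> (nhds l))" and T: "eventually T F"
      and PT: "\<And>k. P k \<Longrightarrow> T k \<Longrightarrow> False"
      unfolding F'_def eventually_inf by auto
    obtain P0 where P0: "eventually P0 (nhds l)" "\<And>k. P0 (\<Phi> k) \<Longrightarrow> P k"
      using P unfolding eventually_filtercomap by blast
    have "eventually (\<lambda>x. \<not> P0 x) (filtermap \<Phi> F)"
      unfolding eventually_filtermap using T by eventually_elim (use PT P0(2) in blast)
    then have "eventually (\<lambda>_. False) (inf (nhds l) (filtermap \<Phi> F))"
      unfolding eventually_inf using P0(1) by blast
    then show False using l(2) by (simp add: trivial_limit_def)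
  qed
  have "filterlim \<Phi> (nhds l) F'"
    unfolding filterlim_def filtermap_le_iff_le_filtercomap F'_def by simp
  then have lim: "((\<lambda>k. inner (p k) y) \<longlongrightarrow> l y) F'" for y
    using continuous_on_tendsto_compose[OF continuous_on_product_coordinates[of y], of \<Phi> l F']
    by (simp add: \<Phi>_def)
  \<comment> \<open>Linearity passes to \<open>l\<close> by uniqueness of limits along
    \<open>F'\<close>; the norm bound is membership in \<open>U\<close>.\<close>
  have "bounded_linear l"
  proof (rule bounded_linear_intro[where K=R])
    show "l (x + y) = l x + l y" for x y
      using tendsto_unique[OF F'bot lim[of "x + y"]] tendsto_add[OF lim[of x] lim[of y]]
      by (simp add: inner_add_right)
    show "l (r *\<^sub>R x) = r *\<^sub>R l x" for r x
      using tendsto_unique[OF F'bot lim[of "r *\<^sub>R x"]] tendsto_mult_left[OF lim[of x], of r]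
      by simp
    show "norm (l x) \<le> norm x * R" for x
      using l(1) by (simp add: U_def PiE_def Pi_def mult.commute)
  qed
  then obtain z where z: "z \<in> S" "\<And>y. y \<in> S \<Longrightarrow> l y = inner z y"
    using riesz_representation_on[OF S] by blast
  moreover have "((\<lambda>k. inner (p k) y) \<longlongrightarrow> inner z y) F'" if "y \<in> S" for y
    using lim[of y] z(2)[OF that] by simp
  moreover have "F' \<le> F" by (simp add: F'_def)
  ultimately show ?thesis using F'bot by blast
qed

section \<open>Weak convergence of Fejer monotone sequences\<close>

lemma fejer_le:
  fixes p :: "nat \<Rightarrow> 'a::real_normed_vector"
  assumes "\<And>k. norm (p (Suc k) - z) \<le> norm (p k - z)"
  shows "norm (p (k + m) - z) \<le> norm (p k - z)"
  by (induction m) (use assms order_trans in auto)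

text \<open>Opial's argument: the difference of two squared distances is affine in \<open>p k\<close>, so along
  a Fejer monotone sequence it separates weak cluster points.\<close>

lemma fejer_weakly_convergent:
  fixes p :: "nat \<Rightarrow> 'a::{real_inner,complete_space}"
  assumes S: "subspace S" "closed S" and pS: "\<And>k. p k \<in> S" and Z: "Z \<noteq> {}"
    and fejer: "\<And>z k. z \<in> Z \<Longrightarrow> norm (p (Suc k) - z) \<le> norm (p k - z)"
    and cluster: "\<And>F z. \<lbrakk>F \<le> sequentially; F \<noteq> bot; z \<in> S;
        \<And>y. y \<in> S \<Longrightarrow> ((\<lambda>k. inner (p k) y) \<longlongrightarrow> inner z y) F\<rbrakk> \<Longrightarrow> z \<in> Z"
    and ZS: "Z \<subseteq> S"
  shows "\<exists>z\<in>Z. converges_weakly_on S p z"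
proof -
  obtain z0 where z0: "z0 \<in> Z" using Z by blast
  have R: "norm (p k) \<le> norm (p 0 - z0) + norm z0" for k
    using fejer_le[of p z0 0 k, OF fejer[OF z0]] norm_triangle_sub[of "p k" z0] by simp
  have conv: "convergent (\<lambda>k. norm (p k - z))" if "z \<in> Z" for z
  proof -
    have "decseq (\<lambda>k. norm (p k - z))" using fejer[OF that] by (rule decseq_SucI)
    then obtain L where "(\<lambda>k. norm (p k - z)) \<longlonglongrightarrow> L"
      using decseq_convergent[of "\<lambda>k. norm (p k - z)" 0] by auto
    then show ?thesis by (rule convergentI)
  qed
  have conv_inner: "convergent (\<lambda>k. inner (p k) (z - z'))" if zz: "z \<in> Z" "z' \<in> Z" for z z'
  proof -
    obtain l l' where "(\<lambda>k. norm (p k - z)) \<longlonglongrightarrow> l" "(\<lambda>k. norm (p k - z')) \<longlonglongrightarrow> l'"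
      using conv zz convergent_def by metis
    then have "(\<lambda>k. ((norm (p k - z'))\<^sup>2 - (norm (p k - z))\<^sup>2 + (norm z)\<^sup>2 - (norm z')\<^sup>2) / 2)
        \<longlonglongrightarrow> (l'\<^sup>2 - l\<^sup>2 + (norm z)\<^sup>2 - (norm z')\<^sup>2) / 2"
      by (intro tendsto_intros) auto
    moreover have eq: "inner x (z - z') = ((norm (x - z'))\<^sup>2 - (norm (x - z))\<^sup>2 + (norm z)\<^sup>2 - (norm z')\<^sup>2) / 2" for x
      unfolding power2_norm_eq_inner by (simp add: algebra_simps inner_commute)
    ultimately show ?thesis unfolding convergent_def eq by blast
  qed
  have unique: "z = z'"
    if F: "F \<le> sequentially" "F \<noteq> bot" "z \<in> S" "\<And>y. y \<in> S \<Longrightarrow> ((\<lambda>k. inner (p k) y) \<longlongrightarrow> inner z y) F"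
      and F': "F' \<le> sequentially" "F' \<noteq> bot" "z' \<in> S" "\<And>y. y \<in> S \<Longrightarrow> ((\<lambda>k. inner (p k) y) \<longlongrightarrow> inner z' y) F'"
    for F F' z z'
  proof -
    have zz: "z \<in> Z" "z' \<in> Z" using cluster F F' by blast+
    then obtain l where l: "(\<lambda>k. inner (p k) (z - z')) \<longlonglongrightarrow> l"
      using conv_inner convergent_def by blast
    \<comment> \<open>Both cluster points see the same limit \<open>l\<close> in the direction
      \<open>z - z'\<close>, which is therefore orthogonal to itself.\<close>
    have d: "z - z' \<in> S" using S(1) F F' subspace_diff by blast
    have "inner z (z - z') = l" using F(2) F(4)[OF d] tendsto_mono[OF F(1) l] by (rule tendsto_unique)
    moreover have "inner z' (z - z') = l" using F'(2) F'(4)[OF d] tendsto_mono[OF F'(1) l] by (rule tendsto_unique)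
    ultimately have "inner (z - z') (z - z') = 0" by (simp add: inner_diff_left)
    then show ?thesis by simp
  qed
  obtain z F where z: "z \<in> S" and F: "F \<le> sequentially" "F \<noteq> bot"
    "\<And>y. y \<in> S \<Longrightarrow> ((\<lambda>k. inner (p k) y) \<longlongrightarrow> inner z y) F"
    using weak_cluster_point_exists[where p=p, OF S sequentially_bot R] by blast
  have "(\<lambda>k. inner (p k) y) \<longlonglongrightarrow> inner z y" if y: "y \<in> S" for y
  proof (rule ccontr)
    assume "\<not> (\<lambda>k. inner (p k) y) \<longlonglongrightarrow> inner z y"
    then obtain e where e: "e > 0"
      "\<not> eventually (\<lambda>k. dist (inner (p k) y) (inner z y) < e) sequentially"
      unfolding tendsto_iff by blast
    \<comment> \<open>\<open>H\<close> restricts \<open>sequentially\<close> to the indices that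
      stay \<open>e\<close> away from the limit. A cluster point along \<open>H\<close> must equal
      \<open>z\<close> by uniqueness, which is contradictory.\<close>
    define H where "H = inf sequentially (principal {k. \<not> dist (inner (p k) y) (inner z y) < e})"
    have "H \<noteq> bot"
      using e(2) unfolding H_def trivial_limit_def eventually_inf_principal by simp
    then obtain z' F' where z': "z' \<in> S" and F': "F' \<le> H" "F' \<noteq> bot"
      "\<And>y. y \<in> S \<Longrightarrow> ((\<lambda>k. inner (p k) y) \<longlongrightarrow> inner z' y) F'"
      using weak_cluster_point_exists[where p=p and F=H, OF S _ R] by blast
    have "F' \<le> sequentially" using F'(1) unfolding H_def by simp
    then have "z = z'" using F z F' z' unique by blast
    then have "eventually (\<lambda>k. dist (inner (p k) y) (inner z y) < e) F'"
      using F'(3)[OF y] e(1) tendstoD by blast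
    moreover have "eventually (\<lambda>k. \<not> dist (inner (p k) y) (inner z y) < e) F'"
      using F'(1) by (simp add: H_def le_principal)
    ultimately have "eventually (\<lambda>k. False) F'" by eventually_elim simp
    then show False using F'(2) by (simp add: trivial_limit_def)
  qed
  then have "converges_weakly_on S p z" using pS z by (simp add: converges_weakly_on_def)
  moreover have "z \<in> Z" using cluster F z by blast
  ultimately show ?thesis by blast
qed

section \<open>Strong convergence and linear rates\<close>

text \<open>Weak convergence gives convergence of the finitely many coefficients with respect to an
  orthogonal spanning set.\<close>

lemma weak_imp_strong_finite_dim:
  fixes p :: "nat \<Rightarrow> 'a::real_inner"
  assumes b: "finite b" and weak: "converges_weakly_on (span b) p z"
  shows "p \<longlonglongrightarrow> z"
proof -
  obtain C where C: "finite C" "span C = span b" "pairwise orthogonal C"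
    using basis_orthogonal[OF b] by blast
  \<comment> \<open>If \<open>C\<close> contains the zero vector, its coefficient is a quotient by
    zero, but the term vanishes all the same.\<close>
  have expand: "x = (\<Sum>c\<in>C. (inner x c / inner c c) *\<^sub>R c)" if x: "x \<in> span b" for x
  proof -
    obtain u where u: "x = (\<Sum>c\<in>C. u c *\<^sub>R c)"
      using x C(1) unfolding C(2)[symmetric] by (auto simp: span_finite)
    have "inner x c = u c * inner c c" if c: "c \<in> C" for c
    proof -
      have "inner x c = (\<Sum>v\<in>C. if v = c then u c * inner c c else 0)"
        unfolding u inner_sum_left
        by (intro sum.cong) (use C(3) c in \<open>auto simp: pairwise_def orthogonal_def\<close>)
      then show ?thesis using C(1) c by simp
    qed
    then have "(\<Sum>c\<in>C. (inner x c / inner c c) *\<^sub>R c) = (\<Sum>c\<in>C. u c *\<^sub>R c)"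
      by (intro sum.cong) auto
    then show ?thesis using u by simp
  qed
  have "(\<lambda>k. \<Sum>c\<in>C. (inner (p k) c / inner c c) *\<^sub>R c) \<longlonglongrightarrow> (\<Sum>c\<in>C. (inner z c / inner c c) *\<^sub>R c)"
  proof (rule tendsto_sum)
    fix c assume "c \<in> C"
    then have "c \<in> span b" using C(2) span_base by blast
    then have lim: "(\<lambda>k. inner (p k) c) \<longlonglongrightarrow> inner z c" using weak by (simp add: converges_weakly_on_def)
    show "(\<lambda>k. (inner (p k) c / inner c c) *\<^sub>R c) \<longlonglongrightarrow> (inner z c / inner c c) *\<^sub>R c"
      unfolding divide_inverse by (intro tendsto_scaleR tendsto_mult lim tendsto_const)
  qed
  moreover have "\<And>k. p k \<in> span b" "z \<in> span b"
    using weak by (auto simp: converges_weakly_on_def)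
  ultimately show ?thesis by (simp add: expand[symmetric])
qed

lemma infdist_ge:
  assumes "Z \<noteq> {}" "\<And>z. z \<in> Z \<Longrightarrow> a \<le> dist x z"
  shows "a \<le> infdist x Z"
  unfolding infdist_notempty[OF assms(1)] using assms by (intro cINF_greatest)

text \<open>Taking the infimum over \<open>Z\<close> turns the descent inequality into one for the
  distances. The error bound then absorbs \<open>r k\<close>, leaving the factor
  \<open>1 - \<sigma> / D\<^sup>2\<close> for squared distances.\<close>

lemma fejer_linear_rate:
  fixes p :: "nat \<Rightarrow> 'a::real_normed_vector"
  assumes Z: "Z \<noteq> {}" and \<sigma>: "0 < \<sigma>" and D: "0 < D"
    and r: "\<And>k. 0 \<le> r k"
    and descent: "\<And>z k. z \<in> Z \<Longrightarrow> (norm (p (Suc k) - z))\<^sup>2 + \<sigma> * (r k)\<^sup>2 \<le> (norm (p k - z))\<^sup>2"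
    and error_bound: "eventually (\<lambda>k. infdist (p k) Z \<le> D * r k) sequentially"
    and lim: "p \<longlonglongrightarrow> pb"
  shows "locally_Q_linear_to_zero (\<lambda>k. infdist (p k) Z)" "locally_R_linear p pb"
proof -
  define d where "d k = infdist (p k) Z" for k
  \<comment> \<open>The maximum with \<open>1 / 4\<close> keeps \<open>c\<close> positive:
    \<open>1 - \<sigma> / D\<^sup>2\<close> may be negative, and the R-linear constant divides by
    \<open>c ^ N\<close>.\<close>
  define c where "c = sqrt (max (1 - \<sigma> / D\<^sup>2) (1 / 4))"
  have d0: "0 \<le> d k" for k by (simp add: d_def infdist_nonneg)
  have "\<sigma> / D\<^sup>2 > 0" using \<sigma> D by simp
  then have c: "0 < c" "c < 1" "c\<^sup>2 \<ge> 1 - \<sigma> / D\<^sup>2" by (auto simp: c_def less_max_iff_disj)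
  have fejer: "norm (p (Suc k) - z) \<le> norm (p k - z)" if "z \<in> Z" for z k
  proof (rule power2_le_imp_le)
    have "0 \<le> \<sigma> * (r k)\<^sup>2" using \<sigma> by simp
    then show "(norm (p (Suc k) - z))\<^sup>2 \<le> (norm (p k - z))\<^sup>2" using descent[OF that, of k] by linarith
  qed simp
  have d_descent: "(d (Suc k))\<^sup>2 + \<sigma> * (r k)\<^sup>2 \<le> (d k)\<^sup>2" for k
  proof -
    \<comment> \<open>The infimum need not be attained, so the bound is proved under the root for
      each \<open>z\<close> and squared afterwards.\<close>
    have "sqrt ((d (Suc k))\<^sup>2 + \<sigma> * (r k)\<^sup>2) \<le> d k"
      unfolding d_def
    proof (rule infdist_ge[OF Z])
      fix z assume z: "z \<in> Z"
      have "infdist (p (Suc k)) Z \<le> norm (p (Suc k) - z)"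
        using infdist_le[OF z] by (simp add: dist_norm)
      then have "(infdist (p (Suc k)) Z)\<^sup>2 \<le> (norm (p (Suc k) - z))\<^sup>2"
        by (intro power_mono infdist_nonneg)
      then have "(infdist (p (Suc k)) Z)\<^sup>2 + \<sigma> * (r k)\<^sup>2 \<le> (dist (p k) z)\<^sup>2"
        using descent[OF z, of k] by (simp add: dist_norm)
      then show "sqrt ((infdist (p (Suc k)) Z)\<^sup>2 + \<sigma> * (r k)\<^sup>2) \<le> dist (p k) z"
        by (intro real_le_lsqrt) auto
    qed
    then have "(sqrt ((d (Suc k))\<^sup>2 + \<sigma> * (r k)\<^sup>2))\<^sup>2 \<le> (d k)\<^sup>2"
      by (intro power_mono) (use \<sigma> in auto)
    then show ?thesis using \<sigma> by simp
  qed
  obtain N where N: "\<And>k. k \<ge> N \<Longrightarrow> d k \<le> D * r k"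
    using error_bound unfolding eventually_sequentially d_def by blast
  have rate: "d (Suc k) \<le> c * d k" if "k \<ge> N" for k
  proof (rule power2_le_imp_le)
    have "(d k)\<^sup>2 \<le> (D * r k)\<^sup>2" using N[OF that] d0 by (rule power_mono)
    then have "\<sigma> / D\<^sup>2 * (d k)\<^sup>2 \<le> \<sigma> / D\<^sup>2 * (D * r k)\<^sup>2" using \<sigma> by (intro mult_left_mono) auto
    also have "\<dots> = \<sigma> * (r k)\<^sup>2" using D by (simp add: power_mult_distrib)
    finally have "(d (Suc k))\<^sup>2 \<le> (1 - \<sigma> / D\<^sup>2) * (d k)\<^sup>2"
      using d_descent[of k] by (simp add: algebra_simps)
    also have "\<dots> \<le> c\<^sup>2 * (d k)\<^sup>2" by (intro mult_right_mono c) auto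
    finally show "(d (Suc k))\<^sup>2 \<le> (c * d k)\<^sup>2" by (simp add: power_mult_distrib)
  qed (use c d0 in auto)
  then show "locally_Q_linear_to_zero (\<lambda>k. infdist (p k) Z)"
    unfolding locally_Q_linear_to_zero_def d_def[symmetric]
    using d0 c by (intro conjI allI exI[of _ N] exI[of _ c]) auto
  have pow: "d (N + j) \<le> c ^ j * d N" for j
  proof (induction j)
    case (Suc j)
    have "d (N + Suc j) \<le> c * d (N + j)" using rate[of "N + j"] by simp
    also have "\<dots> \<le> c * (c ^ j * d N)" using Suc c by (intro mult_left_mono) auto
    finally show ?case by (simp add: mult_ac)
  qed simp
  \<comment> \<open>By the triangle inequality through any \<open>z \<in> Z\<close>, later iterates
    stay within \<open>2 * norm (p k - z)\<close> of \<open>p k\<close>; take the infimum over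
    \<open>z\<close> and let \<open>m\<close> grow.\<close>
  have err: "norm (p k - pb) \<le> 2 * d k" for k
  proof (rule tendsto_upperbound[OF _ _ sequentially_bot])
    show "(\<lambda>m. norm (p k - p (k + m))) \<longlonglongrightarrow> norm (p k - pb)"
      using LIMSEQ_ignore_initial_segment[OF lim, of k]
      by (intro tendsto_intros) (simp add: add.commute)
    have "norm (p k - p (k + m)) \<le> 2 * d k" for m
    proof -
      have "norm (p k - p (k + m)) / 2 \<le> d k"
        unfolding d_def
      proof (rule infdist_ge[OF Z])
        fix z assume z: "z \<in> Z"
        have "norm (p (k + m) - z) \<le> norm (p k - z)" by (rule fejer_le) (rule fejer[OF z])
        then show "norm (p k - p (k + m)) / 2 \<le> dist (p k) z"
          using norm_triangle_ineq4[of "p k - z" "p (k + m) - z"] by (simp add: dist_norm)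
      qed
      then show ?thesis by simp
    qed
    then show "\<forall>\<^sub>F m in sequentially. norm (p k - p (k + m)) \<le> 2 * d k" by simp
  qed
  have "norm (p k - pb) \<le> (2 * d N / c ^ N) * c ^ k" if "k \<ge> N" for k
  proof -
    have "norm (p k - pb) \<le> 2 * (c ^ (k - N) * d N)"
      using err[of k] pow[of "k - N"] that by simp
    also have "\<dots> = (2 * d N / c ^ N) * c ^ k"
      using c that by (simp add: power_diff)
    finally show ?thesis .
  qed
  then show "locally_R_linear p pb"
    unfolding locally_R_linear_def using c d0
    by (intro exI[of _ N] exI[of _ "2 * d N / c ^ N"] conjI exI[of _ c] allI impI) simp_all
qed

section \<open>The projection iteration for a maximally monotone plus a skew operator\<close>

lemma zero_in_plus_singleton: "0 \<in> X + {a} \<longleftrightarrow> - a \<in> X" for a :: "'a::group_add"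
proof
  assume "0 \<in> X + {a}"
  then obtain b where "b \<in> X" "b + a = 0" by (auto simp: set_plus_def)
  then show "- a \<in> X" by (metis eq_neg_iff_add_eq_0)
next
  assume "- a \<in> X"
  then have "- a + a \<in> X + {a}" by (intro set_plus_intro) auto
  then show "0 \<in> X + {a}" by simp
qed

text \<open>Coercivity of \<open>Q\<close> makes \<open>Q + B\<close> strongly monotone, so the
  inverse image of \<open>z\<close> is a singleton and \<open>the_elem\<close> is
  meaningful.\<close>

lemma resolvent_eqI:
  fixes Q :: "'a::real_inner \<Rightarrow> 'a"
  assumes mon: "monotone_op_on S B" and Q: "linear Q"
    and \<epsilon>: "0 < \<epsilon>" "\<And>x. \<epsilon> * (norm x)\<^sup>2 \<le> inner x (Q x)"
    and q: "q \<in> S" "z - Q q \<in> B q"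
  shows "the_elem (inverse_op S (\<lambda>q. {Q q} + B q) z) = q"
proof -
  have mem: "u \<in> inverse_op S (\<lambda>q. {Q q} + B q) z \<longleftrightarrow> u \<in> S \<and> z - Q u \<in> B u" for u
    by (auto simp: inverse_op_def set_plus_def intro!: bexI[of _ "z - Q u"])
  have "u = q" if u: "u \<in> S" "z - Q u \<in> B u" for u
  proof -
    have "0 \<le> inner (u - q) ((z - Q u) - (z - Q q))"
      using mon u q unfolding monotone_op_on_def by blast
    also have "(z - Q u) - (z - Q q) = - Q (u - q)" using Q by (simp add: linear_diff)
    finally have "\<epsilon> * (norm (u - q))\<^sup>2 \<le> 0" using \<epsilon>(2)[of "u - q"] by simp
    then have "(norm (u - q))\<^sup>2 = 0" using \<epsilon>(1) by (simp add: mult_le_0_iff)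
    then show ?thesis by simp
  qed
  then have "inverse_op S (\<lambda>q. {Q q} + B q) z = {q}" using mem q by blast
  then show ?thesis by simp
qed

text \<open>Of the product structure only skewness of \<open>K\<close> and bounds on
  \<open>Q k\<close> uniform in \<open>k\<close> are kept. Assumption \<open>q\<close> is
  conditional on \<open>p k \<in> S\<close> because that membership is itself obtained by induction
  along the iteration.\<close>

locale skew_projection_method =
  fixes S :: "'a::{real_inner,complete_space} set"
    and B :: "'a \<Rightarrow> 'a set" and K :: "'a \<Rightarrow> 'a" and Q :: "nat \<Rightarrow> 'a \<Rightarrow> 'a"
    and p q :: "nat \<Rightarrow> 'a" and \<theta> \<mu> :: "nat \<Rightarrow> real" and \<epsilon>\<theta> \<epsilon> C :: real
  assumes S: "subspace S" "closed S"
    and B: "maximally_monotone_on S B"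
    and K: "bounded_linear K" "\<And>x. x \<in> S \<Longrightarrow> K x \<in> S"
    and skew: "\<And>x y. inner (K x) y = - inner x (K y)"
    and Q: "\<And>k. linear (Q k)" "\<And>k x. x \<in> S \<Longrightarrow> Q k x \<in> S"
    and Q_lower: "\<And>k x. \<epsilon> * (norm x)\<^sup>2 \<le> inner x (Q k x)"
    and Q_upper: "\<And>k x. norm (Q k x - K x) \<le> C * norm x"
    and pos: "0 < \<epsilon>" "0 < C" "0 < \<epsilon>\<theta>"
    and \<theta>: "\<And>k. \<theta> k \<in> {\<epsilon>\<theta>..2 - \<epsilon>\<theta>}"
    and p0: "p 0 \<in> S"
    and q: "\<And>k. p k \<in> S \<Longrightarrow> q k \<in> S \<and> (Q k (p k) - K (p k)) - Q k (q k) \<in> B (q k)"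
    and \<mu>: "\<And>k. \<mu> k = (weighted_norm (Q k) (p k - q k))\<^sup>2 /
        (norm ((Q k (p k) - K (p k)) - (Q k (q k) - K (q k))))\<^sup>2"
    and step: "\<And>k. p (Suc k) = p k - (\<theta> k * \<mu> k) *\<^sub>R
        ((Q k (p k) - K (p k)) - (Q k (q k) - K (q k)))"
    and solution: "zer S (\<lambda>x. B x + {K x}) \<noteq> {}"
begin

abbreviation "Z \<equiv> zer S (\<lambda>x. B x + {K x})"

definition y :: "nat \<Rightarrow> 'a" where
  "y k = (Q k (p k) - K (p k)) - (Q k (q k) - K (q k))"

definition e :: "nat \<Rightarrow> 'a" where "e k = p k - q k"

text \<open>The factor \<open>\<epsilon>\<theta>\<^sup>2\<close> bounds
  \<open>\<theta> k * (2 - \<theta> k)\<close> from below, and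
  \<open>\<epsilon> / C * norm (e k)\<close> bounds the distance from \<open>p k\<close> to the
  half-space.\<close>

definition \<sigma> :: real where "\<sigma> = (\<epsilon>\<theta> * \<epsilon> / C)\<^sup>2"

sublocale K: bounded_linear K by (rule K(1))

lemma inner_K_self [simp]: "inner x (K x) = 0"
  using skew[of x x] by (simp add: inner_commute)

lemma Z_iff: "z \<in> Z \<longleftrightarrow> z \<in> S \<and> - K z \<in> B z"
  by (simp add: zer_def zero_in_plus_singleton)

lemma \<sigma>_pos: "0 < \<sigma>"
  using pos by (simp add: \<sigma>_def)

lemma p_in_S: "p k \<in> S"
proof (induction k)
  case (Suc k)
  then show ?case unfolding step using q[OF Suc] K Q S(1)
    by (intro subspace_diff subspace_scale) auto
qed (rule p0)

lemma q_in_S: "q k \<in> S"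
  and resolvent: "(Q k (p k) - K (p k)) - Q k (q k) \<in> B (q k)"
  using q[OF p_in_S] by auto

lemma y_residual: "(Q k (p k) - K (p k)) - Q k (q k) = y k - K (q k)"
  by (simp add: y_def)

lemma y_in_residual: "y k \<in> B (q k) + {K (q k)}"
  using resolvent[of k] unfolding y_residual set_plus_def by force

lemma y_eq: "y k = Q k (e k) - K (e k)"
  using Q(1)[of k] by (simp add: y_def e_def linear_diff K.diff)

lemma norm_y_le: "norm (y k) \<le> C * norm (e k)"
  unfolding y_eq by (rule Q_upper)

text \<open>The half-space \<open>{z. inner (y k) z \<le> inner (y k) (q k)}\<close> contains all zeros, and
  \<open>p (Suc k)\<close> is a relaxed projection of \<open>p k\<close> onto it.\<close>

lemma separation:
  assumes "z \<in> Z"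
  shows "inner (y k) z \<le> inner (y k) (q k)"
proof -
  have "z \<in> S" "- K z \<in> B z" using assms by (auto simp: Z_iff)
  moreover have "monotone_op_on S B" using B by (simp add: maximally_monotone_on_def)
  \<comment> \<open>Monotonicity of \<open>B\<close> between \<open>q k\<close> and
    \<open>z\<close>; the term \<open>K (q k - z)\<close> then drops out by skewness.\<close>
  ultimately have "0 \<le> inner (q k - z) ((y k - K (q k)) - (- K z))"
    using resolvent[of k] q_in_S[of k] unfolding y_residual monotone_op_on_def by blast
  also have "(y k - K (q k)) - (- K z) = y k - K (q k - z)" by (simp add: K.diff)
  finally show ?thesis by (simp add: inner_diff_right inner_diff_left inner_commute)
qed

text \<open>A relaxed projection onto a half-space containing \<open>z\<close> lowers the squared
  distance to \<open>z\<close> by at least \<open>\<theta> k * (2 - \<theta> k) * m\<^sup>2\<close>,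
  where \<open>m\<close> is the distance from \<open>p k\<close> to the half-space.\<close>

lemma descent:
  assumes z: "z \<in> Z"
  shows "(norm (p (Suc k) - z))\<^sup>2 + \<sigma> * (norm (e k))\<^sup>2 \<le> (norm (p k - z))\<^sup>2"
proof (cases "e k = 0")
  case True
  \<comment> \<open>The update vanishes whatever the value of \<open>\<mu> k\<close>, which is 0/0
    here.\<close>
  then have "y k = 0" using norm_y_le[of k] by simp
  then show ?thesis using True step[of k] by (simp add: y_def)
next
  case False
  define a where "a = inner (e k) (Q k (e k))"
  define N where "N = norm (y k)"
  have e_pos: "0 < norm (e k)" using False by simp
  have a_low: "\<epsilon> * (norm (e k))\<^sup>2 \<le> a" unfolding a_def by (rule Q_lower)
  have "0 < \<epsilon> * (norm (e k))\<^sup>2" using pos e_pos by simp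
  then have a_pos: "0 < a" using a_low by linarith
  \<comment> \<open>Skewness removes \<open>K\<close>, so pairing \<open>y k\<close> with
    \<open>e k\<close> leaves the squared weighted norm.\<close>
  have a_y: "inner (y k) (e k) = a"
    by (simp add: y_eq a_def inner_commute[of _ "e k"] inner_diff_right)
  then have "y k \<noteq> 0" using a_pos by auto
  then have N_pos: "0 < N" by (simp add: N_def)
  have N_up: "N \<le> C * norm (e k)" unfolding N_def by (rule norm_y_le)
  have \<mu>k: "\<mu> k = a / N\<^sup>2"
    using a_pos by (simp add: \<mu> weighted_norm_def a_def N_def y_def e_def)
  \<comment> \<open>The distance from \<open>p k\<close> to the half-space:
    \<open>inner (y k) (p k - q k)\<close> over the norm of \<open>y k\<close>.\<close>
  define m where "m = a / N"
  have m: "\<epsilon> / C * norm (e k) \<le> m"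
  proof -
    have "\<epsilon> / C * norm (e k) * N \<le> \<epsilon> / C * norm (e k) * (C * norm (e k))"
      using N_up pos by (intro mult_left_mono) auto
    also have "\<dots> = \<epsilon> * (norm (e k))\<^sup>2" using pos by (simp add: power2_eq_square)
    finally have "\<epsilon> / C * norm (e k) * N \<le> a" using a_low by linarith
    then show ?thesis unfolding m_def using N_pos by (simp add: pos_le_divide_eq)
  qed
  have "(\<epsilon> / C * norm (e k))\<^sup>2 \<le> m\<^sup>2"
    using m pos by (intro power_mono) auto
  moreover have \<theta>2: "\<epsilon>\<theta>\<^sup>2 \<le> \<theta> k * (2 - \<theta> k)"
    using \<theta>[of k] pos unfolding power2_eq_square by (intro mult_mono) auto
  moreover have "0 \<le> \<theta> k * (2 - \<theta> k)"
    using \<theta>2 zero_le_power2[of \<epsilon>\<theta>] by linarith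
  ultimately have "\<epsilon>\<theta>\<^sup>2 * (\<epsilon> / C * norm (e k))\<^sup>2 \<le> \<theta> k * (2 - \<theta> k) * m\<^sup>2"
    by (intro mult_mono) simp_all
  then have gain: "\<sigma> * (norm (e k))\<^sup>2 \<le> \<theta> k * (2 - \<theta> k) * m\<^sup>2"
    by (simp add: \<sigma>_def power_mult_distrib power_divide mult_ac)
  have "inner (y k) (p k - z) \<ge> a"
    using separation[OF z, of k] a_y by (simp add: e_def inner_diff_right)
  then have gap: "2 * (\<theta> k * \<mu> k) * a \<le> 2 * (\<theta> k * \<mu> k) * inner (y k) (p k - z)"
    using \<theta>[of k] pos a_pos by (intro mult_left_mono) (auto simp: \<mu>k)
  have step': "p (Suc k) - z = (p k - z) - (\<theta> k * \<mu> k) *\<^sub>R y k"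
    by (simp add: step y_def)
  have norm_diff: "(norm (w - c *\<^sub>R v))\<^sup>2 = (norm w)\<^sup>2 - 2 * c * inner v w + c\<^sup>2 * (norm v)\<^sup>2" for w v :: 'a and c
    unfolding power2_norm_eq_inner by (simp add: algebra_simps inner_commute power2_eq_square)
  have "(norm (p (Suc k) - z))\<^sup>2
      = (norm (p k - z))\<^sup>2 - 2 * (\<theta> k * \<mu> k) * inner (y k) (p k - z) + (\<theta> k * \<mu> k)\<^sup>2 * N\<^sup>2"
    unfolding N_def step' norm_diff ..
  moreover have "(\<theta> k * \<mu> k)\<^sup>2 * N\<^sup>2 = (\<theta> k)\<^sup>2 * m\<^sup>2" "\<theta> k * \<mu> k * a = \<theta> k * m\<^sup>2"
    using N_pos by (simp_all add: \<mu>k m_def power2_eq_square)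
  moreover have "\<theta> k * (2 - \<theta> k) * m\<^sup>2 = 2 * (\<theta> k * m\<^sup>2) - (\<theta> k)\<^sup>2 * m\<^sup>2"
    by (simp add: algebra_simps power2_eq_square)
  ultimately show ?thesis using gain gap by argo
qed

lemma fejer: "z \<in> Z \<Longrightarrow> norm (p (Suc k) - z) \<le> norm (p k - z)"
proof (rule power2_le_imp_le)
  assume "z \<in> Z"
  moreover have "0 \<le> \<sigma> * (norm (e k))\<^sup>2" using \<sigma>_pos by simp
  ultimately show "(norm (p (Suc k) - z))\<^sup>2 \<le> (norm (p k - z))\<^sup>2" using descent[of z k] by linarith
qed simp

text \<open>The squared distances to a fixed zero decrease and hence converge; their consecutive
  differences, which dominate \<open>\<sigma> * (norm (e k))\<^sup>2\<close>, vanish.\<close>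

lemma e_tendsto_0: "e \<longlonglongrightarrow> 0"
proof -
  obtain z where z: "z \<in> Z" using solution by blast
  have "decseq (\<lambda>k. (norm (p k - z))\<^sup>2)"
    using fejer[OF z] by (intro decseq_SucI power_mono) auto
  then obtain l where l: "(\<lambda>k. (norm (p k - z))\<^sup>2) \<longlonglongrightarrow> l"
    using decseq_convergent[of "\<lambda>k. (norm (p k - z))\<^sup>2" 0] by auto
  have "(\<lambda>k. (norm (p k - z))\<^sup>2 - (norm (p (Suc k) - z))\<^sup>2) \<longlonglongrightarrow> l - l"
    by (intro tendsto_diff l LIMSEQ_Suc)
  then have "(\<lambda>k. ((norm (p k - z))\<^sup>2 - (norm (p (Suc k) - z))\<^sup>2) / \<sigma>) \<longlonglongrightarrow> (l - l) / \<sigma>"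
    using \<sigma>_pos by (intro tendsto_divide tendsto_const) auto
  then have lim: "(\<lambda>k. ((norm (p k - z))\<^sup>2 - (norm (p (Suc k) - z))\<^sup>2) / \<sigma>) \<longlonglongrightarrow> 0" by simp
  have le: "(norm (e k))\<^sup>2 \<le> ((norm (p k - z))\<^sup>2 - (norm (p (Suc k) - z))\<^sup>2) / \<sigma>" for k
    using descent[OF z, of k] \<sigma>_pos by (simp add: pos_le_divide_eq mult.commute)
  have "(\<lambda>k. (norm (e k))\<^sup>2) \<longlonglongrightarrow> 0"
    by (rule tendsto_sandwich[OF _ _ tendsto_const lim]) (use le in auto)
  then have "(\<lambda>k. sqrt ((norm (e k))\<^sup>2)) \<longlonglongrightarrow> sqrt 0" by (rule tendsto_real_sqrt)
  then show ?thesis by (simp add: tendsto_norm_zero_iff)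
qed

lemma y_tendsto_0: "y \<longlonglongrightarrow> 0"
proof (rule Lim_null_comparison)
  show "\<forall>\<^sub>F k in sequentially. norm (y k) \<le> C * norm (e k)" using norm_y_le by simp
  show "(\<lambda>k. C * norm (e k)) \<longlonglongrightarrow> 0"
    using tendsto_mult_left[OF tendsto_norm[OF e_tendsto_0], of C] by simp
qed

section \<open>Weak convergence of the iterates\<close>

text \<open>Monotonicity is tested against arbitrary graph points of \<open>B\<close> and passed to
  the limit. The problematic term \<open>inner (q k) (K (q k))\<close> vanishes by skewness; the
  others are affine in \<open>q k\<close> or paired with \<open>y k\<close>.\<close>

lemma weak_cluster_point_is_zero:
  assumes F: "F \<le> sequentially" "F \<noteq> bot" and z: "z \<in> S"
    and weak: "\<And>v. v \<in> S \<Longrightarrow> ((\<lambda>k. inner (p k) v) \<longlongrightarrow> inner z v) F"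
  shows "z \<in> Z"
proof -
  have BS: "B \<in> S \<rightarrow> Pow S" and mon: "monotone_op_on S B"
    using B by (auto simp: maximally_monotone_on_def)
  have e0: "(e \<longlongrightarrow> 0) F" and y0: "(y \<longlongrightarrow> 0) F"
    using tendsto_mono[OF F(1)] e_tendsto_0 y_tendsto_0 by blast+
  have weak_q: "((\<lambda>k. inner (q k) v) \<longlongrightarrow> inner z v) F" if "v \<in> S" for v
  proof -
    have "((\<lambda>k. inner (p k) v - inner (e k) v) \<longlongrightarrow> inner z v - inner 0 v) F"
      by (intro tendsto_intros weak that e0)
    then show ?thesis by (simp add: e_def inner_diff_left)
  qed
  obtain z0 where z0: "z0 \<in> Z" using solution by blast
  define R where "R = norm (p 0 - z0) + norm z0"
  have R: "norm (p k) \<le> R" for k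
    using fejer_le[of p z0 0 k, OF fejer[OF z0]] norm_triangle_sub[of "p k" z0]
    by (simp add: R_def)
  \<comment> \<open>Weak convergence of \<open>p k\<close> would not control this pairing;
    boundedness of \<open>p k\<close> and strong convergence of \<open>y k\<close> do.\<close>
  have py0: "((\<lambda>k. inner (p k) (y k)) \<longlongrightarrow> 0) F"
  proof (rule Lim_null_comparison)
    have "norm (inner (p k) (y k)) \<le> R * norm (y k)" for k
      using Cauchy_Schwarz_ineq2[of "p k" "y k"] mult_right_mono[OF R[of k] norm_ge_zero[of "y k"]]
      by simp
    then show "\<forall>\<^sub>F k in F. norm (inner (p k) (y k)) \<le> R * norm (y k)" by simp
    show "((\<lambda>k. R * norm (y k)) \<longlongrightarrow> 0) F"
      using tendsto_mult_left[OF tendsto_norm[OF y0], of R] by simp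
  qed
  have qy0: "((\<lambda>k. inner (q k) (y k)) \<longlongrightarrow> 0) F"
  proof -
    have "((\<lambda>k. inner (p k) (y k) - inner (e k) (y k)) \<longlongrightarrow> 0 - inner 0 (0::'a)) F"
      by (intro tendsto_intros py0 e0 y0)
    then show ?thesis by (simp add: e_def inner_diff_left)
  qed
  have "- K z \<in> B z"
  proof (rule maximally_monotone_on_mem[OF B z])
    show "- K z \<in> S" using K(2) z S(1) by (simp add: subspace_neg)
    fix a b assume ab: "a \<in> S" "b \<in> B a"
    then have bS: "b \<in> S" using BS by blast
    \<comment> \<open>This is \<open>inner (q k - a) ((y k - K (q k)) - b)\<close> expanded, with
      \<open>K\<close> moved onto \<open>a\<close> by skewness.\<close>
    have "((\<lambda>k. inner (q k) (y k) - inner a (y k) - inner (q k) b + inner a b - inner (q k) (K a))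
        \<longlongrightarrow> 0 - inner a 0 - inner z b + inner a b - inner z (K a)) F"
      by (intro tendsto_intros qy0 y0 weak_q bS K(2) ab)
    moreover have "0 \<le> inner (q k) (y k) - inner a (y k) - inner (q k) b + inner a b - inner (q k) (K a)" for k
    proof -
      have "0 \<le> inner (q k - a) ((y k - K (q k)) - b)"
        using mon resolvent[of k] q_in_S[of k] ab unfolding y_residual monotone_op_on_def by blast
      then show ?thesis using skew[of "q k" a]
        by (simp add: inner_diff_left inner_diff_right inner_commute)
    qed
    ultimately have "0 \<le> 0 - inner a 0 - inner z b + inner a b - inner z (K a)"
      using F(2) by (intro tendsto_lowerbound) (auto intro: always_eventually)
    then show "0 \<le> inner (z - a) (- K z - b)" using skew[of z a]
      by (simp add: inner_diff_left inner_diff_right inner_commute)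
  qed
  then show ?thesis using z by (simp add: Z_iff)
qed

lemma weakly_convergent: "\<exists>z\<in>Z. converges_weakly_on S p z"
  using S p_in_S solution fejer weak_cluster_point_is_zero
  by (rule fejer_weakly_convergent) (auto simp: zer_def)

section \<open>Error bound from metric subregularity\<close>

text \<open>Subregularity is applied at \<open>q k\<close>, where the small residual
  \<open>y k\<close> is available, and not at \<open>p k\<close>; the triangle inequality adds
  \<open>norm (e k)\<close>.\<close>

lemma error_bound:
  assumes lim: "p \<longlonglongrightarrow> z" and sub: "metrically_subregular_on S (\<lambda>x. B x + {K x}) z 0"
  shows "\<exists>D>0. eventually (\<lambda>k. infdist (p k) Z \<le> D * norm (e k)) sequentially"
proof -
  have inv: "inverse_op S (\<lambda>x. B x + {K x}) 0 = Z" by (simp add: inverse_op_def zer_def)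
  obtain \<kappa> U V where \<kappa>: "0 \<le> \<kappa>" and U: "open U" "z \<in> U" and V: "open V" "0 \<in> V"
    and bound: "\<And>x. x \<in> U \<inter> S \<Longrightarrow>
      set_dist x Z \<le> ereal \<kappa> * set_dist 0 ((B x + {K x}) \<inter> V)"
    using sub unfolding metrically_subregular_on_def inv by blast
  have "(\<lambda>k. p k - e k) \<longlonglongrightarrow> z - 0" by (intro tendsto_diff lim e_tendsto_0)
  then have "q \<longlonglongrightarrow> z" by (simp add: e_def)
  then have "\<forall>\<^sub>F k in sequentially. q k \<in> U" using U by (rule topological_tendstoD)
  moreover have "\<forall>\<^sub>F k in sequentially. y k \<in> V" using y_tendsto_0 V by (rule topological_tendstoD)
  ultimately have "\<forall>\<^sub>F k in sequentially. infdist (p k) Z \<le> (1 + \<kappa> * C) * norm (e k)"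
  proof eventually_elim
    case (elim k)
    define W where "W = (B (q k) + {K (q k)}) \<inter> V"
    have yW: "y k \<in> W" using y_in_residual elim by (simp add: W_def)
    have "set_dist (q k) Z \<le> ereal \<kappa> * set_dist 0 W"
      unfolding W_def using bound elim q_in_S by blast
    then have "infdist (q k) Z \<le> \<kappa> * infdist 0 W"
    proof -
      assume "set_dist (q k) Z \<le> ereal \<kappa> * set_dist 0 W"
      \<comment> \<open>Since \<open>W\<close> contains \<open>y k\<close> and zeros exist, neither
        extended distance is infinite.\<close>
      moreover have "W \<noteq> {}" using yW by blast
      ultimately show ?thesis using solution by (simp add: set_dist_def)
    qed
    also have "\<dots> \<le> \<kappa> * norm (y k)"
      using infdist_le[OF yW, of 0] \<kappa> by (intro mult_left_mono) auto
    also have "\<dots> \<le> \<kappa> * (C * norm (e k))" using \<kappa> norm_y_le by (intro mult_left_mono)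
    finally show ?case
      using infdist_triangle[of "p k" Z "q k"] by (simp add: e_def dist_norm algebra_simps)
  qed
  moreover have "0 < 1 + \<kappa> * C" using \<kappa> pos by (simp add: add_pos_nonneg)
  ultimately show ?thesis by blast
qed

theorem convergence:
  "\<exists>z\<in>Z. converges_weakly_on S p z \<and>
     ((\<forall>z\<in>Z. metrically_subregular_on S (\<lambda>x. B x + {K x}) z 0) \<and> (\<exists>b. finite b \<and> span b = S) \<longrightarrow>
      locally_R_linear p z \<and> locally_Q_linear_to_zero (\<lambda>k. infdist (p k) Z))"
proof -
  obtain z where z: "z \<in> Z" "converges_weakly_on S p z" using weakly_convergent by blast
  have "locally_R_linear p z \<and> locally_Q_linear_to_zero (\<lambda>k. infdist (p k) Z)"
    if sub: "\<forall>z\<in>Z. metrically_subregular_on S (\<lambda>x. B x + {K x}) z 0" and b: "finite b" "span b = S" for b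
  proof -
    have lim: "p \<longlonglongrightarrow> z" using weak_imp_strong_finite_dim[OF b(1)] z(2) b(2) by simp
    obtain D where D: "0 < D" "eventually (\<lambda>k. infdist (p k) Z \<le> D * norm (e k)) sequentially"
      using error_bound[OF lim] sub z(1) by blast
    show ?thesis
      using fejer_linear_rate[OF solution \<sigma>_pos D(1) norm_ge_zero descent D(2) lim] by blast
  qed
  then show ?thesis using z by blast
qed

end

section \<open>The product space operators\<close>

lemma norm_vec_prod_le:
  fixes p :: "('g::real_normed_vector^'m::finite) \<times> 'h::real_normed_vector"
  shows "norm p \<le> (\<Sum>i\<in>UNIV. norm (fst p $ i)) + norm (snd p)"
proof -
  have "norm p \<le> norm (fst p) + norm (snd p)" using norm_Pair_le[of "fst p" "snd p"] by simp
  moreover have "norm (fst p) \<le> (\<Sum>i\<in>UNIV. norm (fst p $ i))"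
    unfolding norm_vec_def by (intro L2_set_le_sum) auto
  ultimately show ?thesis by linarith
qed

lemma norm_component_le:
  fixes p :: "('g::real_normed_vector^'m::finite) \<times> 'h::real_normed_vector"
  shows "norm (fst p $ i) \<le> norm p" "norm (snd p) \<le> norm p"
proof -
  have "norm (fst p) \<le> norm p" using norm_fst_le[of "fst p" "snd p"] by simp
  then show "norm (fst p $ i) \<le> norm p" using Finite_Cartesian_Product.norm_nth_le[of "fst p" i] by linarith
  show "norm (snd p) \<le> norm p" using norm_snd_le[of "snd p" "fst p"] by simp
qed

lemma subspace_prod_space:
  fixes G :: "'m::finite \<Rightarrow> 'g::real_vector set"
  assumes "\<And>i. subspace (G i)"
  shows "subspace (prod_space G :: (('g^'m) \<times> 'h::real_vector) set)"
  using assms by (auto simp: subspace_def prod_space_def)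

lemma closed_prod_space:
  fixes G :: "'m::finite \<Rightarrow> 'g::real_normed_vector set"
  assumes "\<And>i. closed (G i)"
  shows "closed (prod_space G :: (('g^'m) \<times> 'h::real_normed_vector) set)"
proof -
  have "prod_space G = (\<Inter>i. (\<lambda>p :: ('g^'m) \<times> 'h. fst p $ i) -` G i)"
    by (auto simp: prod_space_def)
  moreover have "closed ((\<lambda>p :: ('g^'m) \<times> 'h. fst p $ i) -` G i)" for i
    using assms by (intro closed_vimage continuous_intros)
  ultimately show ?thesis by auto
qed

lemma bounded_linear_op_K:
  fixes L :: "'m::finite \<Rightarrow> 'h::{real_inner,complete_space} \<Rightarrow> 'g::real_inner"
  assumes L: "\<And>i. bounded_linear (L i)"
  shows "bounded_linear (op_K L)"
proof -
  interpret L: bounded_linear "L i" for i by (rule L)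
  interpret L': bounded_linear "adjoint (L i)" for i by (rule adjoint_bounded_linear(2)[OF L])
  obtain b where b: "\<And>i. 0 \<le> b i" "\<And>i x. norm (L i x) \<le> norm x * b i"
    using L.nonneg_bounded by metis
  obtain b' where b': "\<And>i. 0 \<le> b' i" "\<And>i x. norm (adjoint (L i) x) \<le> norm x * b' i"
    using L'.nonneg_bounded by metis
  show ?thesis
  proof (rule bounded_linear_intro)
    show "op_K L (p + q) = op_K L p + op_K L q" for p q
      by (simp add: op_K_def L.add L'.add sum.distrib vec_eq_iff)
    show "op_K L (r *\<^sub>R p) = r *\<^sub>R op_K L p" for r p
      by (simp add: op_K_def L.scaleR L'.scaleR scaleR_sum_right vec_eq_iff)
    show "norm (op_K L p) \<le> norm p * ((\<Sum>i\<in>UNIV. b i) + (\<Sum>i\<in>UNIV. b' i))" for p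
    proof -
      have "norm (op_K L p) \<le> (\<Sum>i\<in>UNIV. norm (L i (snd p))) + norm (\<Sum>i\<in>UNIV. adjoint (L i) (fst p $ i))"
        using norm_vec_prod_le[of "op_K L p"] by (simp add: op_K_def)
      also have "\<dots> \<le> (\<Sum>i\<in>UNIV. norm p * b i) + (\<Sum>i\<in>UNIV. norm p * b' i)"
      proof (intro add_mono sum_mono sum_norm_le)
        show "norm (L i (snd p)) \<le> norm p * b i" for i
          using b(2)[of i "snd p"] mult_right_mono[OF norm_component_le(2)[of p] b(1)[of i]] by linarith
        show "norm (adjoint (L i) (fst p $ i)) \<le> norm p * b' i" for i
          using b'(2)[of i "fst p $ i"] mult_right_mono[OF norm_component_le(1)[of p i] b'(1)[of i]] by linarith
      qed
      finally show ?thesis by (simp add: sum_distrib_left distrib_left)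
    qed
  qed
qed

text \<open>The two off-diagonal blocks are negative adjoints of each other.\<close>

lemma op_K_skew:
  fixes L :: "'m::finite \<Rightarrow> 'h::{real_inner,complete_space} \<Rightarrow> 'g::real_inner"
  assumes L: "\<And>i. bounded_linear (L i)"
  shows "inner (op_K L p) q = - inner p (op_K L q)"
proof -
  have adj: "inner (adjoint (L i) v) x = inner v (L i x)" for i v x
    using adjoint_bounded_linear(1)[OF L, of i x v] by (simp add: inner_commute)
  have "inner (op_K L p) q = - (\<Sum>i\<in>UNIV. inner (L i (snd p)) (fst q $ i)) + (\<Sum>i\<in>UNIV. inner (fst p $ i) (L i (snd q)))"
    by (simp add: op_K_def inner_prod_def inner_vec_def inner_sum_left adj sum_negf)
  moreover have "inner p (op_K L q) = - (\<Sum>i\<in>UNIV. inner (fst p $ i) (L i (snd q))) + (\<Sum>i\<in>UNIV. inner (L i (snd p)) (fst q $ i))"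
    by (simp add: op_K_def inner_prod_def inner_vec_def inner_sum_right adj sum_negf
        adjoint_bounded_linear(1)[OF L, symmetric])
  ultimately show ?thesis by simp
qed

lemma linear_op_Q: "linear (op_Q \<tau> \<tau>n)"
  by (rule linearI) (simp_all add: op_Q_def vec_eq_iff scaleR_add_right mult.commute)

lemma op_Q_lower:
  fixes p :: "('g::real_inner^'m::finite) \<times> 'h::real_inner"
  assumes "\<And>i. \<epsilon> \<le> \<tau> i" "\<epsilon> \<le> inverse \<tau>n"
  shows "\<epsilon> * (norm p)\<^sup>2 \<le> inner p (op_Q \<tau> \<tau>n p)"
proof -
  have "\<epsilon> * (norm p)\<^sup>2 = (\<Sum>i\<in>UNIV. \<epsilon> * inner (fst p $ i) (fst p $ i)) + \<epsilon> * inner (snd p) (snd p)"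
    by (simp add: power2_norm_eq_inner inner_prod_def inner_vec_def sum_distrib_left distrib_left)
  also have "\<dots> \<le> (\<Sum>i\<in>UNIV. \<tau> i * inner (fst p $ i) (fst p $ i)) + inverse \<tau>n * inner (snd p) (snd p)"
    by (intro add_mono sum_mono mult_right_mono assms inner_ge_zero)
  also have "\<dots> = inner p (op_Q \<tau> \<tau>n p)"
    by (simp add: op_Q_def inner_prod_def inner_vec_def)
  finally show ?thesis .
qed

text \<open>The factor \<open>real CARD('m) + 1\<close> counts the components, since the product
  norm is estimated by the sum of their norms.\<close>

lemma op_Q_upper:
  fixes p :: "('g::real_inner^'m::finite) \<times> 'h::real_inner"
  assumes "\<And>i. \<bar>\<tau> i\<bar> \<le> c" "\<bar>inverse \<tau>n\<bar> \<le> c"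
  shows "norm (op_Q \<tau> \<tau>n p) \<le> (real CARD('m) + 1) * c * norm p"
proof -
  have c: "0 \<le> c" using assms(2) by linarith
  have "norm (op_Q \<tau> \<tau>n p) \<le> (\<Sum>i\<in>UNIV. \<bar>\<tau> i\<bar> * norm (fst p $ i)) + \<bar>inverse \<tau>n\<bar> * norm (snd p)"
    using norm_vec_prod_le[of "op_Q \<tau> \<tau>n p"] by (simp add: op_Q_def)
  also have "\<dots> \<le> (\<Sum>i\<in>(UNIV::'m set). c * norm p) + c * norm p"
    by (intro add_mono sum_mono mult_mono assms norm_component_le c norm_ge_zero)
  finally show ?thesis by (simp add: algebra_simps)
qed

section \<open>The block operator and its zeros\<close>

text \<open>Both operators are block diagonal, so Minty's theorem solves each component
  separately.\<close>

lemma op_B_resolvent_exists: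
  fixes G :: "'m::finite \<Rightarrow> 'g::{real_inner,complete_space} set"
    and An :: "'h::{real_inner,complete_space} \<Rightarrow> 'h set"
  assumes G: "\<And>i. subspace (G i)" "\<And>i. closed (G i)"
    and A: "\<And>i. maximally_monotone_on (G i) (A i)" and An: "maximally_monotone_on UNIV An"
    and \<tau>: "\<And>i. 0 < \<tau> i" "0 < \<tau>n" and z: "z \<in> prod_space G"
  shows "\<exists>q\<in>prod_space G. z - op_Q \<tau> \<tau>n q \<in> op_B G A An q"
proof -
  have "\<exists>w\<in>G i. fst z $ i - \<tau> i *\<^sub>R w \<in> inverse_op (G i) (A i) w" for i
    using z by (intro minty_surjective G maximally_monotone_on_inverse A \<tau>) (simp add: prod_space_def)
  then obtain w where w: "\<And>i. w i \<in> G i" "\<And>i. fst z $ i - \<tau> i *\<^sub>R w i \<in> inverse_op (G i) (A i) (w i)"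
    by metis
  obtain x where x: "snd z - inverse \<tau>n *\<^sub>R x \<in> An x"
    using minty_surjective[OF _ _ An, of "inverse \<tau>n" "snd z"] \<tau>(2) by auto
  show ?thesis
    by (rule bexI[of _ "((\<chi> i. w i), x)"]) (use w x in \<open>auto simp: op_B_def op_Q_def prod_space_def\<close>)
qed

text \<open>With unit weights the resolvent is everywhere defined, and the converse of Minty's
  theorem gives maximality.\<close>

lemma op_B_maximally_monotone:
  fixes G :: "'m::finite \<Rightarrow> 'g::{real_inner,complete_space} set"
    and An :: "'h::{real_inner,complete_space} \<Rightarrow> 'h set"
  assumes G: "\<And>i. subspace (G i)" "\<And>i. closed (G i)"
    and A: "\<And>i. maximally_monotone_on (G i) (A i)" and An: "maximally_monotone_on UNIV An"
  shows "maximally_monotone_on (prod_space G) (op_B G A An)"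
proof (rule monotone_surjective_imp_maximal)
  show "subspace (prod_space G :: (('g^'m) \<times> 'h) set)" using G(1) by (rule subspace_prod_space)
  show "op_B G A An \<in> prod_space G \<rightarrow> Pow (prod_space G)"
    by (auto simp: op_B_def prod_space_def inverse_op_def)
  have mon: "monotone_op_on (G i) (inverse_op (G i) (A i))" for i
    using maximally_monotone_on_inverse[OF A] by (simp add: maximally_monotone_on_def)
  have monn: "monotone_op_on UNIV An" using An by (simp add: maximally_monotone_on_def)
  show "monotone_op_on (prod_space G) (op_B G A An)"
    unfolding monotone_op_on_def
  proof (intro ballI)
    fix x y u v :: "('g^'m) \<times> 'h"
    assume xy: "x \<in> prod_space G" "y \<in> prod_space G" and uv: "u \<in> op_B G A An x" "v \<in> op_B G A An y"
    have "0 \<le> inner (fst x $ i - fst y $ i) (fst u $ i - fst v $ i)" for i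
      using mon[of i] xy uv unfolding monotone_op_on_def prod_space_def op_B_def by blast
    moreover have "0 \<le> inner (snd x - snd y) (snd u - snd v)"
      using monn uv unfolding monotone_op_on_def op_B_def by blast
    ultimately show "0 \<le> inner (x - y) (u - v)"
      unfolding inner_prod_def inner_vec_def by (intro add_nonneg_nonneg sum_nonneg) auto
  qed
  have "op_Q (\<lambda>_. 1) 1 q = q" for q :: "('g^'m) \<times> 'h" by (simp add: op_Q_def)
  then show "\<exists>x\<in>prod_space G. z - x \<in> op_B G A An x" if "z \<in> prod_space G" for z
    using op_B_resolvent_exists[OF G A An _ _ that, of "\<lambda>_. 1" 1] by simp
qed

text \<open>The elements of \<open>A i (L i x)\<close> that witness the inclusion are the dual
  variables; paired with the primal solution \<open>x\<close> they form a Kuhn-Tucker point.\<close>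

lemma kkt_solution:
  assumes A: "\<And>i. A i \<in> G i \<rightarrow> Pow (G i)" and L: "\<And>i. range (L i) \<subseteq> G i"
    and x: "0 \<in> An x + (\<Sum>i\<in>UNIV. adjoint (L i) ` A i (L i x))"
  shows "zer (prod_space G) (\<lambda>q. op_B G A An q + {op_K L q}) \<noteq> {}"
proof -
  obtain u s where u: "u \<in> An x" and s: "s \<in> (\<Sum>i\<in>UNIV. adjoint (L i) ` A i (L i x))" and us: "0 = u + s"
    using x by (auto simp: set_plus_def)
  obtain t where t: "s = sum t UNIV" "\<And>i. t i \<in> adjoint (L i) ` A i (L i x)"
    using s by (auto simp: set_sum_alt)
  obtain w where w: "\<And>i. w i \<in> A i (L i x)" "\<And>i. t i = adjoint (L i) (w i)"
    using t(2) unfolding image_iff by metis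
  have LG: "L i x \<in> G i" for i using L by blast
  then have wG: "w i \<in> G i" for i using A w(1) by blast
  have "u = - s" using us by (metis eq_neg_iff_add_eq_0)
  then have "- op_K L ((\<chi> i. w i), x) \<in> op_B G A An ((\<chi> i. w i), x)"
    using u w LG t(1) by (simp add: op_K_def op_B_def inverse_op_def)
  then have "((\<chi> i. w i), x) \<in> zer (prod_space G) (\<lambda>q. op_B G A An q + {op_K L q})"
    using wG by (simp add: zer_def prod_space_def zero_in_plus_singleton)
  then show ?thesis by blast
qed

theorem proposition9:
  fixes G :: "'m::finite \<Rightarrow> 'g::{real_inner,complete_space} set"
    and A :: "'m \<Rightarrow> 'g \<Rightarrow> 'g set"
    and An :: "'h::{real_inner,complete_space} \<Rightarrow> 'h set"
    and L :: "'m \<Rightarrow> 'h \<Rightarrow> 'g"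
    and \<theta> :: "nat \<Rightarrow> real" and \<epsilon>\<theta> \<epsilon> :: real
    and \<tau> :: "nat \<Rightarrow> 'm \<Rightarrow> real" and \<tau>n :: "nat \<Rightarrow> real"
    and p0 :: "('g^'m) \<times> 'h"
    and p phat :: "nat \<Rightarrow> ('g^'m) \<times> 'h"
    and \<mu> :: "nat \<Rightarrow> real"
  assumes G: "\<And>i. subspace (G i)" "\<And>i. closed (G i)"
    and A: "\<And>i. maximally_monotone_on (G i) (A i)"
    and An: "maximally_monotone_on UNIV An"
    and L: "\<And>i. bounded_linear (L i)" "\<And>i. range (L i) \<subseteq> G i"
    and solution: "{x. 0 \<in> An x + (\<Sum>i\<in>UNIV. adjoint (L i) ` A i (L i x))} \<noteq> {}"
    and \<epsilon>\<theta>: "0 < \<epsilon>\<theta>" "\<epsilon>\<theta> < 1"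
    and \<theta>: "\<And>k. \<theta> k \<in> {\<epsilon>\<theta>..2 - \<epsilon>\<theta>}"
    and \<epsilon>: "0 < \<epsilon>" "\<epsilon> < 1"
    and \<tau>: "\<And>k i. \<tau> k i \<in> {\<epsilon>..1 / \<epsilon>}"
    and \<tau>n: "\<And>k. \<tau>n k \<in> {\<epsilon>..1 / \<epsilon>}"
    and p0: "p0 \<in> prod_space G" "p 0 = p0"
    and phat: "\<And>k. phat k =
        the_elem (inverse_op (prod_space G)
          (\<lambda>q. {op_Q (\<tau> k) (\<tau>n k) q} + op_B G A An q)
          (op_Q (\<tau> k) (\<tau>n k) (p k) - op_K L (p k)))"
    and \<mu>: "\<And>k. \<mu> k =
        (weighted_norm (op_Q (\<tau> k) (\<tau>n k)) (p k - phat k))\<^sup>2 /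
        (norm ((op_Q (\<tau> k) (\<tau>n k) (p k) - op_K L (p k))
               - (op_Q (\<tau> k) (\<tau>n k) (phat k) - op_K L (phat k))))\<^sup>2"
    and step: "\<And>k. p (Suc k) =
        p k - (\<theta> k * \<mu> k) *\<^sub>R
          ((op_Q (\<tau> k) (\<tau>n k) (p k) - op_K L (p k))
           - (op_Q (\<tau> k) (\<tau>n k) (phat k) - op_K L (phat k)))"
  shows "\<exists>pbar \<in> zer (prod_space G) (\<lambda>q. op_B G A An q + {op_K L q}).
      converges_weakly_on (prod_space G) p pbar \<and>
      ((\<forall>z \<in> zer (prod_space G) (\<lambda>q. op_B G A An q + {op_K L q}).
          metrically_subregular_on (prod_space G) (\<lambda>q. op_B G A An q + {op_K L q}) z 0) \<and>
       (\<exists>b. finite b \<and> span b = (prod_space G :: (('g^'m) \<times> 'h) set)) \<longrightarrow>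
       locally_R_linear p pbar \<and>
       locally_Q_linear_to_zero
         (\<lambda>k. infdist (p k) (zer (prod_space G) (\<lambda>q. op_B G A An q + {op_K L q}))))"
proof -
  let ?S = "prod_space G :: (('g^'m) \<times> 'h) set"
  have K: "bounded_linear (op_K L)" using L(1) by (rule bounded_linear_op_K)
  obtain c where c: "0 < c" "\<And>x. norm (op_K L x) \<le> norm x * c"
    using bounded_linear.pos_bounded[OF K] by blast
  \<comment> \<open>The bound of \<open>op_Q_upper\<close> for weights at most
    \<open>1 / \<epsilon>\<close>, plus the bound \<open>c\<close> of \<open>op_K L\<close>.\<close>
  define C where "C = (real CARD('m) + 1) * (1 / \<epsilon>) + c"
  have \<tau>_pos: "0 < \<tau> k i" "0 < \<tau>n k" for k i
    using \<tau>[of k i] \<tau>n[of k] \<epsilon>(1) by auto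
  \<comment> \<open>The interval from \<open>\<epsilon>\<close> to \<open>1 / \<epsilon>\<close> is
    invariant under inversion.\<close>
  have inv_\<tau>n: "\<epsilon> \<le> inverse (\<tau>n k)" "inverse (\<tau>n k) \<le> 1 / \<epsilon>" for k
    using \<tau>n[of k] \<tau>_pos(2)[of k] \<epsilon>(1) by (auto simp: field_simps)
  have Q_lower: "\<epsilon> * (norm x)\<^sup>2 \<le> inner x (op_Q (\<tau> k) (\<tau>n k) x)" for k and x :: "('g^'m) \<times> 'h"
    using \<tau> inv_\<tau>n by (intro op_Q_lower) auto
  have BM: "maximally_monotone_on ?S (op_B G A An)" by (rule op_B_maximally_monotone[OF G A An])
  have S: "subspace ?S" "closed ?S"
    by (rule subspace_prod_space[OF G(1)], rule closed_prod_space[OF G(2)])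
  have K_S: "op_K L x \<in> ?S" for x
    using L(2) G(1) by (auto simp: prod_space_def op_K_def intro!: subspace_neg)
  have Q_S: "op_Q (\<tau> k) (\<tau>n k) x \<in> ?S" if "x \<in> ?S" for k x
    using that G(1) by (auto simp: prod_space_def op_Q_def intro!: subspace_scale)
  interpret skew_projection_method ?S "op_B G A An" "op_K L" "\<lambda>k. op_Q (\<tau> k) (\<tau>n k)" p phat \<theta> \<mu> \<epsilon>\<theta> \<epsilon> C
  proof (rule skew_projection_method.intro)
    show "norm (op_Q (\<tau> k) (\<tau>n k) x - op_K L x) \<le> C * norm x" for k x
    proof -
      have "norm (op_Q (\<tau> k) (\<tau>n k) x) \<le> (real CARD('m) + 1) * (1 / \<epsilon>) * norm x"
        using \<tau> \<tau>_pos inv_\<tau>n by (intro op_Q_upper) (auto simp: abs_of_pos)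
      then show ?thesis
        using norm_triangle_ineq4[of "op_Q (\<tau> k) (\<tau>n k) x" "op_K L x"] c(2)[of x]
        by (simp add: C_def algebra_simps)
    qed
    show "0 < C" unfolding C_def using c \<epsilon> by (intro add_pos_pos mult_pos_pos) auto
    \<comment> \<open>Componentwise Minty gives a resolvent point \<open>q\<close>, and uniqueness
      identifies it with \<open>phat k\<close>.\<close>
    show "phat k \<in> ?S \<and> op_Q (\<tau> k) (\<tau>n k) (p k) - op_K L (p k) - op_Q (\<tau> k) (\<tau>n k) (phat k)
        \<in> op_B G A An (phat k)" if "p k \<in> ?S" for k
    proof -
      have "op_Q (\<tau> k) (\<tau>n k) (p k) - op_K L (p k) \<in> ?S"
        using Q_S[OF that] K_S S(1) by (intro subspace_diff)
      from op_B_resolvent_exists[where \<tau>="\<tau> k" and \<tau>n="\<tau>n k", OF G A An \<tau>_pos this] obtain q where q: "q \<in> ?S"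
        "op_Q (\<tau> k) (\<tau>n k) (p k) - op_K L (p k) - op_Q (\<tau> k) (\<tau>n k) q \<in> op_B G A An q" by blast
      have "monotone_op_on ?S (op_B G A An)" using BM by (simp add: maximally_monotone_on_def)
      from resolvent_eqI[OF this linear_op_Q \<epsilon>(1) Q_lower q] have "phat k = q" using phat by simp
      then show ?thesis using q by simp
    qed
    obtain x where x: "0 \<in> An x + (\<Sum>i\<in>UNIV. adjoint (L i) ` A i (L i x))" using solution by blast
    have "A i \<in> G i \<rightarrow> Pow (G i)" for i using A by (simp add: maximally_monotone_on_def)
    from kkt_solution[where A=A and G=G and L=L and An=An, OF this L(2) x]
    show "zer ?S (\<lambda>q. op_B G A An q + {op_K L q}) \<noteq> {}" .
  qed (rule S BM K K_S op_K_skew L(1) linear_op_Q Q_S Q_lower \<epsilon>(1) \<epsilon>\<theta>(1) \<theta>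
      p0(1)[folded p0(2)] \<mu> step | assumption)+
  show ?thesis by (rule convergence)
qed

end
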